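(* Let $F$ be a field and let $n>1$ be an integer. The largest irredundant generating sets for the $F$-algebra $\mathrm{M}_n(F)$ of $n\times n$ matrices over $F$ have $2n-1$ elements. That is, there exists an irredundant generating set for $\mathrm{M}_n(F)$ with exactly $2n-1$ elements, and every irredundant generating set for $\mathrm{M}_n(F)$ has at most $2n-1$ elements.
   Context: A subset $S\subseteq \mathrm{M}_n(F)$ is called an irredundant generating set for $\mathrm{M}_n(F)$ if $S$ generates $\mathrm{M}_n(F)$ as a unital $F$-algebra and no proper subset of $S$ generates $\mathrm{M}_n(F)$ as a unital $F$-algebra. *)

theory Defs
  imports Jordan_Normal_Form.Matrix
begin

text \<open>
  \<open>carrier_mat n n\<close> plays the role of the matrix algebra \<open>M_n(F)\<close>, where the field \<open>F\<close> is the
  type \<^typ>\<open>'a\<close> of class \<^class>\<open>field\<close>. Zero and additive inverses need not be mentioned below,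
  since they are scalar multiples of members.
\<close>

definition unital_subalgebra :: "nat \<Rightarrow> 'a::field mat set \<Rightarrow> bool" where
  "unital_subalgebra n A \<longleftrightarrow>
     A \<subseteq> carrier_mat n n \<and>
     1\<^sub>m n \<in> A \<and>
     (\<forall>X\<in>A. \<forall>Y\<in>A. X + Y \<in> A) \<and>
     (\<forall>X\<in>A. \<forall>Y\<in>A. X * Y \<in> A) \<and>
     (\<forall>c. \<forall>X\<in>A. c \<cdot>\<^sub>m X \<in> A)"

definition generates :: "nat \<Rightarrow> 'a::field mat set \<Rightarrow> bool" where
  "generates n S \<longleftrightarrow> S \<subseteq> carrier_mat n n \<and> unital_subalgebra n hull S = carrier_mat n n"

definition irredundant_generating_set :: "nat \<Rightarrow> 'a::field mat set \<Rightarrow> bool" where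
  "irredundant_generating_set n S \<longleftrightarrow> generates n S \<and> (\<forall>T. T \<subset> S \<longrightarrow> \<not> generates n T)"

end

theory Submission
  imports Defs "HOL-Algebra.Algebraic_Closure_Type" "HOL-Library.Function_Algebras"
begin

text \<open>
  Lower bound: the matrices \<open>E\<^bsub>i+1,i+1\<^esub> - E\<^bsub>i+1,i\<^esub>\<close>, \<open>E\<^bsub>i,i\<^esub> - E\<^bsub>i,i+1\<^esub>\<close> for \<open>i < n - 1\<close> together with
  \<open>E\<^bsub>n-1,n-1\<^esub>\<close> generate, and each of them can be separated from the others by the stabiliser of a
  subspace.

  Upper bound: every generating set contains a generating subset with at most \<open>2n - 1\<close> members. After
  extending scalars to the algebraic closure, generating means acting irreducibly. So let a finite
  family act irreducibly on \<open>U\<close>, minimally so, and induct on \<open>dim U\<close>. If each of the subfamilies omitting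
  one member has a common eigenvector, then these eigenvectors contain a circuit spanning \<open>U\<close>, and the
  family has at most \<open>dim U + 1\<close> members. Otherwise, omitting some member, there is a minimal invariant
  subspace \<open>W\<close> with \<open>1 < dim W = p < dim U\<close>, and by induction at most \<open>2p - 1\<close> members act irreducibly on
  \<open>W\<close>. Let \<open>B\<close> be the algebra they generate. If some element of \<open>B\<close> not vanishing on \<open>W\<close> has rank one on
  \<open>U\<close>, say \<open>u \<mapsto> \<phi>(u) w\<close>, then at most \<open>dim U - p\<close> members make \<open>w\<close> a generator of \<open>U\<close>, another
  \<open>dim U - p\<close> remove all submodules of the kernel of \<open>\<phi>\<close>, and then \<open>U\<close> is irreducible. If there is no such
  element, then \<open>B\<close> has an element \<open>g\<close> of rank at most \<open>dim U - p\<close> that generates the unit ideal; the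
  compressions \<open>g b s b'\<close> act irreducibly on \<open>g U\<close>, and the induction hypothesis for \<open>g U\<close> provides at most
  \<open>2 (dim U - p) - 1\<close> further members.
\<close>

section \<open>Finite-dimensional subspaces\<close>

locale endo_space = vector_space scale
  for scale :: "'a::field \<Rightarrow> 'v::ab_group_add \<Rightarrow> 'v"
begin

abbreviation "indep B \<equiv> \<not> dependent B"

text \<open>A property of a subset and not of the space: the type \<open>'v\<close> is later a type
  of functions on the naturals, which is infinite-dimensional.\<close>

definition fin_dim :: "'v set \<Rightarrow> bool" where
  "fin_dim W \<longleftrightarrow> (\<exists>B. finite B \<and> W \<subseteq> span B)"

lemma fin_dim_mono: "fin_dim U \<Longrightarrow> W \<subseteq> U \<Longrightarrow> fin_dim W"
  unfolding fin_dim_def by blast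

lemma fin_dim_independent_extend:
  assumes "fin_dim U" "subspace U" "indep B" "B \<subseteq> U"
  obtains C where "B \<subseteq> C" "finite C" "indep C" "span C = U" "card C = dim U"
proof -
  obtain C where C: "B \<subseteq> C" "C \<subseteq> U" "indep C" "U \<subseteq> span C"
    using maximal_independent_subset_extend[OF assms(4,3)] by blast
  obtain A where A: "finite A" "U \<subseteq> span A" using assms(1) unfolding fin_dim_def by blast
  have "finite C" using independent_span_bound[OF A(1) C(3)] C(2) A(2) by blast
  moreover have "span C = U" using C(2,4) assms(2) span_minimal by blast
  ultimately show ?thesis using that C basis_card_eq_dim by blast
qed

lemma fin_dim_basis:
  assumes "fin_dim U" "subspace U"
  obtains B where "finite B" "indep B" "span B = U" "card B = dim U"
  using fin_dim_independent_extend[OF assms independent_empty] by blast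

lemma dim_subset_fin_dim:
  assumes "fin_dim U" "W \<subseteq> U"
  shows "dim W \<le> dim U"
proof -
  have "fin_dim (span U)" using assms(1) unfolding fin_dim_def
    by (metis span_minimal subspace_span)
  then obtain B where "finite B" "span B = span U" "card B = dim U"
    by (rule fin_dim_basis) (auto simp: subspace_span)
  then show ?thesis using dim_le_card[of W B] assms(2) span_superset[of U] by fastforce
qed

text \<open>A basis of \<open>W\<close> extends to a basis of \<open>U\<close>, and by the dimension
  hypothesis the extension adds nothing.\<close>

lemma subspace_eqI_dim:
  assumes "fin_dim U" "subspace U" "subspace W" "W \<subseteq> U" "dim U \<le> dim W"
  shows "W = U"
proof -
  obtain B where B: "finite B" "indep B" "span B = W" "card B = dim W"
    by (rule fin_dim_basis[OF fin_dim_mono[OF assms(1,4)] assms(3)])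
  have "B \<subseteq> U" using B(3) assms(4) span_superset by blast
  obtain C where C: "B \<subseteq> C" "finite C" "indep C" "span C = U" "card C = dim U"
    by (rule fin_dim_independent_extend[OF assms(1,2) B(2) \<open>B \<subseteq> U\<close>])
  have "B = C" by (rule card_seteq) (use B C assms(5) in auto)
  then show ?thesis using B(3) C(4) by simp
qed

lemma dim_psubset_fin_dim:
  assumes "fin_dim U" "subspace U" "subspace W" "W \<subset> U"
  shows "dim W < dim U"
  using subspace_eqI_dim[OF assms(1-3)] assms(4) by fastforce

lemma dim_eq_0_fin_dim:
  assumes "fin_dim U" "subspace U"
  shows "dim U = 0 \<longleftrightarrow> U = {0}"
proof
  assume "dim U = 0"
  then have "{0} = U" using assms by (intro subspace_eqI_dim) (auto simp: subspace_0)
  then show "U = {0}" by simp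
next
  assume "U = {0}"
  then have "U \<subseteq> span {}" by simp
  then show "dim U = 0" using dim_le_card[of U "{}"] by simp
qed

lemma dim_span_singleton: "v \<noteq> 0 \<Longrightarrow> dim (span {v}) = 1"
  by (subst dim_span_eq_card_independent) auto

lemma exists_dim_1_span:
  assumes "fin_dim U" "subspace U" "dim U = 1"
  obtains v where "v \<noteq> 0" "U = span {v}"
proof -
  obtain B where B: "finite B" "indep B" "span B = U" "card B = dim U"
    by (rule fin_dim_basis[OF assms(1,2)])
  then obtain v where "B = {v}" using assms(3) card_1_singletonE by metis
  then show ?thesis using that[of v] B by auto
qed

text \<open>The union of a basis of \<open>K\<close> and a basis of \<open>W\<close> is independent:
  a relation splits into \<open>b = - c\<close>, a vector common to both spaces, so both parts
  vanish.\<close>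

lemma dim_add_le_if_disjoint:
  assumes U: "fin_dim U" and K: "subspace K" "K \<subseteq> U" and W: "subspace W" "W \<subseteq> U"
    and disj: "K \<inter> W = {0}"
  shows "dim K + dim W \<le> dim U"
proof -
  obtain B where B: "finite B" "indep B" "span B = K" "card B = dim K"
    by (rule fin_dim_basis[OF fin_dim_mono[OF U K(2)] K(1)])
  obtain C where C: "finite C" "indep C" "span C = W" "card C = dim W"
    by (rule fin_dim_basis[OF fin_dim_mono[OF U W(2)] W(1)])
  have "0 \<notin> B" using B(2) dependent_zero by blast
  moreover have "B \<inter> C \<subseteq> K \<inter> W" using B(3) C(3) span_superset by blast
  ultimately have BC: "B \<inter> C = {}" using disj by auto
  have "indep (B \<union> C)"
  proof (rule independent_if_scalars_zero)
    show "finite (B \<union> C)" using B C by simp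
    fix f x assume s: "(\<Sum>x\<in>B \<union> C. scale (f x) x) = 0" and x: "x \<in> B \<union> C"
    define b c where "b = (\<Sum>x\<in>B. scale (f x) x)" and "c = (\<Sum>x\<in>C. scale (f x) x)"
    have "b + c = 0" using s B(1) C(1) BC by (simp add: sum.union_disjoint b_def c_def)
    then have bc: "b = - c" by (simp add: eq_neg_iff_add_eq_0)
    have "b \<in> K" unfolding b_def B(3)[symmetric] by (intro span_sum span_scale span_base)
    moreover have c: "c \<in> W" unfolding c_def C(3)[symmetric] by (intro span_sum span_scale span_base)
    moreover have "b \<in> W" unfolding bc using c W(1) subspace_neg by blast
    ultimately have "b = 0" using disj by auto
    then have "c = 0" using bc by simp
    then show "f x = 0"
      using x independentD[OF B(2,1) subset_refl] independentD[OF C(2,1) subset_refl] \<open>b = 0\<close>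
      unfolding b_def c_def by blast
  qed
  then have "card (B \<union> C) = dim (B \<union> C)" by (simp add: dim_eq_card_independent)
  also have "\<dots> \<le> dim U"
    using B(3) C(3) K(2) W(2) span_superset[of B] span_superset[of C]
    by (intro dim_subset_fin_dim U) blast
  finally show ?thesis using B C BC by (simp add: card_Un_disjoint)
qed

section \<open>Linear maps and rank-nullity on a subspace\<close>

interpretation pair: vector_space_pair scale scale ..

abbreviation "lin \<equiv> Vector_Spaces.linear scale scale"

lemma linI:
  assumes "\<And>x y. f (x + y) = f x + f y" "\<And>c x. f (scale c x) = scale c (f x)"
  shows "lin f"
  by (intro Vector_Spaces.linear_iff[THEN iffD2] conjI allI assms vector_space_axioms)

lemmas lin_add = pair.linear_add and lin_scale = pair.linear_scale and lin_0 = pair.linear_0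
  and lin_diff = pair.linear_diff and lin_sum = pair.linear_sum

lemma lin_id: "lin id" "lin (\<lambda>v. v)" by (auto intro: linI)

lemma lin_comp: "lin f \<Longrightarrow> lin g \<Longrightarrow> lin (f \<circ> g)"
  by (auto intro!: linI simp: lin_add lin_scale)

lemma lin_plus: "lin f \<Longrightarrow> lin g \<Longrightarrow> lin (\<lambda>v. f v + g v)"
  by (auto intro!: linI simp: lin_add lin_scale algebra_simps)

lemma lin_smult: "lin f \<Longrightarrow> lin (\<lambda>v. scale c (f v))"
  by (auto intro!: linI simp: lin_add lin_scale algebra_simps)

lemma lin_minus: "lin f \<Longrightarrow> lin g \<Longrightarrow> lin (\<lambda>v. f v - g v)"
  by (auto intro!: linI simp: lin_add lin_scale algebra_simps)

lemma lin_funpow: "lin f \<Longrightarrow> lin (f ^^ k)"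
  by (induction k) (auto intro: lin_id lin_comp)

lemma subspace_image: "lin f \<Longrightarrow> subspace U \<Longrightarrow> subspace (f ` U)"
  by (rule pair.linear_subspace_image)

lemma subspace_kernel_on: "lin f \<Longrightarrow> subspace U \<Longrightarrow> subspace {u \<in> U. f u = 0}"
  by (auto simp: subspace_def lin_add lin_scale lin_0)

lemma fin_dim_image:
  assumes "lin f" "fin_dim U" shows "fin_dim (f ` U)"
proof -
  obtain B where "finite B" "U \<subseteq> span B" using assms(2) unfolding fin_dim_def by blast
  then have "f ` U \<subseteq> span (f ` B)" using pair.linear_span_image[OF assms(1)] by blast
  then show ?thesis unfolding fin_dim_def using \<open>finite B\<close> by blast
qed

text \<open>A basis \<open>B\<close> of the kernel extends to a basis \<open>C\<close> of
  \<open>U\<close>; \<open>f\<close> is injective on the span of \<open>D = C - B\<close> and maps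
  \<open>D\<close> to a basis of the image.\<close>

lemma rank_nullity_on:
  assumes f: "lin f" and U: "fin_dim U" "subspace U"
  shows "dim (f ` U) + dim {u \<in> U. f u = 0} = dim U"
proof -
  let ?K = "{u \<in> U. f u = 0}"
  have K: "subspace ?K" "?K \<subseteq> U" using subspace_kernel_on[OF f U(2)] by auto
  obtain B where B: "finite B" "indep B" "span B = ?K" "card B = dim ?K"
    by (rule fin_dim_basis[OF fin_dim_mono[OF U(1) K(2)] K(1)])
  have "B \<subseteq> U" using B(3) K(2) span_superset by blast
  obtain C where C: "B \<subseteq> C" "finite C" "indep C" "span C = U" "card C = dim U"
    by (rule fin_dim_independent_extend[OF U B(2) \<open>B \<subseteq> U\<close>])
  define D where "D = C - B"
  have D: "finite D" "D \<subseteq> U" "indep D"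
    using C span_superset[of C] independent_mono[OF C(3)] unfolding D_def by auto
  have "span D \<inter> span B \<subseteq> {0}"
  proof
    fix v assume v: "v \<in> span D \<inter> span B"
    obtain r where r: "v = (\<Sum>x\<in>D. scale (r x) x)" using v span_finite[OF D(1)] by auto
    obtain s where s: "v = (\<Sum>x\<in>B. scale (s x) x)" using v span_finite[OF B(1)] by auto
    \<comment> \<open>Two expansions of one vector, over \<open>D\<close> and over \<open>B\<close>,
      combine to a relation on the independent set \<open>C\<close>, so all coefficients
      vanish.\<close>
    let ?g = "\<lambda>x. if x \<in> D then r x else - s x"
    have "C = D \<union> B" "D \<inter> B = {}" using C(1) unfolding D_def by auto
    then have "(\<Sum>x\<in>C. scale (?g x) x) = (\<Sum>x\<in>D. scale (?g x) x) + (\<Sum>x\<in>B. scale (?g x) x)"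
      using D(1) B(1) by (simp add: sum.union_disjoint)
    also have "(\<Sum>x\<in>D. scale (?g x) x) = v" unfolding r by (rule sum.cong) auto
    also have "(\<Sum>x\<in>B. scale (?g x) x) = - v"
      unfolding s sum_negf[symmetric] using \<open>D \<inter> B = {}\<close> by (intro sum.cong) auto
    finally have sum0: "(\<Sum>x\<in>C. scale (?g x) x) = 0" by simp
    have "r x = 0" if "x \<in> D" for x
    proof -
      have "x \<in> C" using that unfolding D_def by simp
      then have "?g x = 0" by (rule independentD[OF C(3,2) subset_refl sum0])
      then show ?thesis using that by simp
    qed
    then have "v = 0" unfolding r by (intro sum.neutral) auto
    then show "v \<in> {0}" by simp
  qed
  then have inj: "inj_on f (span D)"
  proof (subst pair.linear_inj_on_iff_eq_0[OF f subspace_span], safe)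
    fix v assume v: "v \<in> span D" "f v = 0"
    have "span D \<subseteq> U" using D(2) U(2) span_minimal by blast
    then have "v \<in> span B" using v B(3) by auto
    then show "v = 0" using v \<open>span D \<inter> span B \<subseteq> {0}\<close> by auto
  qed
  have ind: "indep (f ` D)"
    using pair.linear_independent_injective_image[OF f D(3) inj] .
  have "f ` U \<subseteq> span (f ` D)"
  proof
    fix y assume "y \<in> f ` U"
    then have "y \<in> span (f ` C)" using C(4) pair.linear_span_image[OF f] by auto
    moreover have "f ` C \<subseteq> span (f ` D)"
    proof
      fix z assume "z \<in> f ` C"
      then obtain c where c: "c \<in> C" "z = f c" by auto
      show "z \<in> span (f ` D)"
      proof (cases "c \<in> B")
        case True
        then have "c \<in> ?K" using B(3) span_superset by blast
        then show ?thesis using c span_zero by simp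
      next
        case False
        then show ?thesis using c unfolding D_def by (auto intro: span_base)
      qed
    qed
    ultimately show "y \<in> span (f ` D)" using span_minimal[OF _ subspace_span] by blast
  qed
  then have "card (f ` D) = dim (f ` U)"
    using D(2) ind by (intro basis_card_eq_dim) auto
  moreover have "card (f ` D) = card D"
    by (rule card_image) (use inj inj_on_subset span_superset in blast)
  moreover have "card C = card D + card B"
    unfolding D_def using C(1,2) B(1) by (simp add: card_Diff_subset card_mono)
  ultimately show ?thesis using C(5) B(4) by simp
qed

lemma inj_on_if_dim_image_eq:
  assumes "lin f" "fin_dim U" "subspace U" "dim U \<le> dim (f ` U)" "u \<in> U" "f u = 0"
  shows "u = 0"
proof -
  have "dim {u \<in> U. f u = 0} = 0" using rank_nullity_on[OF assms(1-3)] assms(4) by simp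
  then have "{u \<in> U. f u = 0} = {0}"
    using assms fin_dim_mono[OF assms(2)]
    by (subst dim_eq_0_fin_dim[symmetric]) (auto intro: subspace_kernel_on)
  then show ?thesis using assms by auto
qed

lemma dim_image_less:
  assumes "lin f" "fin_dim U" "subspace U" "u \<in> U" "f u = 0" "u \<noteq> 0"
  shows "dim (f ` U) < dim U"
  using inj_on_if_dim_image_eq[OF assms(1-3)] assms(4-6) by (meson not_le)

end

section \<open>Generated algebras and ideals of endomorphisms\<close>

context endo_space
begin

section \<open>Polynomials in an endomorphism and Fitting's lemma\<close>

definition poly_act :: "('v \<Rightarrow> 'v) \<Rightarrow> 'a poly \<Rightarrow> 'v \<Rightarrow> 'v" where
  "poly_act f p v = (\<Sum>i\<le>degree p. scale (coeff p i) ((f ^^ i) v))"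

lemma poly_act_extend:
  assumes "degree p \<le> n"
  shows "poly_act f p v = (\<Sum>i\<le>n. scale (coeff p i) ((f ^^ i) v))"
  unfolding poly_act_def using assms
  by (intro sum.mono_neutral_left) (auto simp: not_le coeff_eq_0)

lemma poly_act_0 [simp]: "poly_act f 0 v = 0"
  by (simp add: poly_act_def)

lemma poly_act_pCons:
  assumes "lin f"
  shows "poly_act f (pCons a p) v = scale a v + f (poly_act f p v)"
proof -
  have "poly_act f (pCons a p) v = (\<Sum>i\<le>Suc (degree p). scale (coeff (pCons a p) i) ((f ^^ i) v))"
    by (rule poly_act_extend) (rule degree_pCons_le)
  also have "\<dots> = scale a v + f (poly_act f p v)"
    unfolding poly_act_def lin_sum[OF assms] lin_scale[OF assms]
    by (subst sum.atMost_Suc_shift) simp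
  finally show ?thesis .
qed

lemma poly_act_1 [simp]: "poly_act f 1 v = v"
  by (simp add: poly_act_def)

lemma poly_act_add: "poly_act f (p + q) v = poly_act f p v + poly_act f q v"
proof -
  let ?n = "max (degree p) (degree q)"
  have "degree (p + q) \<le> ?n" by (rule degree_add_le_max)
  then show ?thesis
    by (simp add: poly_act_extend[of _ ?n] sum.distrib scale_left_distrib)
qed

lemma poly_act_smult: "poly_act f (smult c p) v = scale c (poly_act f p v)"
  using degree_smult_le[of c p] by (simp add: poly_act_extend[of _ "degree p"] scale_sum_right)

lemma poly_act_diff: "poly_act f (p - q) v = poly_act f p v - poly_act f q v"
  using poly_act_add[of f p "- q" v] poly_act_smult[of f "-1" q v] by simp

lemma poly_act_mult:
  assumes "lin f"
  shows "poly_act f (p * q) v = poly_act f p (poly_act f q v)"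
proof (induction p)
  case (pCons a p)
  then show ?case
    by (simp add: poly_act_add poly_act_smult poly_act_pCons[OF assms] lin_0[OF assms])
qed simp

lemma poly_act_monom: "poly_act f (monom c k) v = scale c ((f ^^ k) v)"
proof -
  have "(\<Sum>i\<le>k. scale (coeff (monom c k) i) ((f ^^ i) v)) = scale c ((f ^^ k) v)"
    by (simp add: if_distrib[of "\<lambda>a. scale a _"] sum.delta cong: if_cong)
  then show ?thesis
    using poly_act_extend[of "monom c k" k f v] degree_monom_le by metis
qed

lemma poly_act_in: "subspace U \<Longrightarrow> f ` U \<subseteq> U \<Longrightarrow> u \<in> U \<Longrightarrow> poly_act f p u \<in> U"
proof -
  assume U: "subspace U" "f ` U \<subseteq> U" "u \<in> U"
  have "(f ^^ i) u \<in> U" for i using U by (induction i) auto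
  then show ?thesis unfolding poly_act_def by (intro subspace_sum subspace_scale U)
qed

lemma lin_poly_act: "lin f \<Longrightarrow> lin (poly_act f p)"
  unfolding poly_act_def
  by (intro linI)
    (simp_all add: lin_add[OF lin_funpow] lin_scale[OF lin_funpow] sum.distrib
      scale_right_distrib scale_sum_right mult.commute)

lemma poly_act_commute: "lin f \<Longrightarrow> poly_act f p (f v) = f (poly_act f p v)"
  using poly_act_mult[of f p "[:0, 1:]" v] poly_act_mult[of f "[:0, 1:]" p v]
  by (simp add: poly_act_pCons lin_0 mult.commute)

text \<open>If no nonzero polynomial killed \<open>u\<close>, the iterates of \<open>f\<close> at
  \<open>u\<close> would be independent, too many for the finite spanning set of
  \<open>U\<close>.\<close>

lemma annihilator_vector:
  assumes f: "lin f" and U: "fin_dim U" "subspace U" "f ` U \<subseteq> U" "u \<in> U"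
  shows "\<exists>p. p \<noteq> 0 \<and> poly_act f p u = 0"
proof (rule ccontr)
  assume no: "\<nexists>p. p \<noteq> 0 \<and> poly_act f p u = 0"
  \<comment> \<open>The alternative \<open>p = 0\<close> serves \<open>k = 0\<close>: the span is
    then \<open>{0}\<close>, but the zero polynomial has degree \<open>0\<close>, which is not below
    \<open>k\<close>.\<close>
  have span_eq: "\<exists>p. (degree p < k \<or> p = 0) \<and> v = poly_act f p u"
    if "v \<in> span ((\<lambda>i. (f ^^ i) u) ` {..<k})" for v k
    using that
  proof (induction rule: span_induct_alt)
    case base
    show ?case by (rule exI[of _ 0]) simp
  next
    case (step c x y)
    then obtain p i where p: "degree p < k \<or> p = 0" "y = poly_act f p u" "i < k" "x = (f ^^ i) u" by auto
    have "degree (monom c i + p) < k"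
      using p(1,3) degree_monom_le[of c i] by (auto intro!: degree_add_less)
    moreover have "scale c x + y = poly_act f (monom c i + p) u"
      using p by (simp add: poly_act_add poly_act_monom)
    ultimately show ?case by blast
  qed
  have notin: "(f ^^ k) u \<notin> span ((\<lambda>i. (f ^^ i) u) ` {..<k})" for k
  proof
    assume "(f ^^ k) u \<in> span ((\<lambda>i. (f ^^ i) u) ` {..<k})"
    then obtain p where p: "degree p < k \<or> p = 0" "(f ^^ k) u = poly_act f p u"
      using span_eq by blast
    have "coeff (monom 1 k - p) k = 1" using p(1) by (auto simp: coeff_eq_0)
    then have "monom 1 k - p \<noteq> 0" by auto
    moreover have "poly_act f (monom 1 k - p) u = 0"
      using p(2) by (simp add: poly_act_diff poly_act_monom)
    ultimately show False using no by blast
  qed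
  have ind: "indep ((\<lambda>i. (f ^^ i) u) ` {..<k}) \<and> card ((\<lambda>i. (f ^^ i) u) ` {..<k}) = k" for k
  proof (induction k)
    case (Suc k)
    have "(f ^^ k) u \<notin> (\<lambda>i. (f ^^ i) u) ` {..<k}" using notin[of k] by (rule contrapos_nn) (rule span_base)
    then show ?case using Suc notin[of k]
      by (simp add: lessThan_Suc independent_insertI)
  qed (simp add: independent_empty)
  obtain B where B: "finite B" "U \<subseteq> span B" using U(1) unfolding fin_dim_def by blast
  have "(f ^^ i) u \<in> U" for i using U(3,4) by (induction i) auto
  then have "(\<lambda>i. (f ^^ i) u) ` {..<Suc (card B)} \<subseteq> span B" using B(2) by auto
  from independent_span_bound[OF B(1) _ this] show False using ind[of "Suc (card B)"] by simp
qed

text \<open>The product of annihilators of the basis vectors works, since the factors commute and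
  each can act first.\<close>

lemma annihilator_subspace:
  assumes f: "lin f" and U: "fin_dim U" "subspace U" "f ` U \<subseteq> U"
  obtains p where "p \<noteq> 0" "\<And>u. u \<in> U \<Longrightarrow> poly_act f p u = 0"
proof -
  obtain B where B: "finite B" "span B = U" using fin_dim_basis[OF U(1,2)] by metis
  have "\<exists>p. p \<noteq> 0 \<and> (\<forall>b\<in>C. poly_act f p b = 0)" if "finite C" "C \<subseteq> U" for C
    using that
  proof (induction C)
    case empty
    show ?case by (rule exI[of _ 1]) simp
  next
    case (insert c C)
    then obtain p where p: "p \<noteq> 0" "\<forall>b\<in>C. poly_act f p b = 0" by auto
    obtain q where q: "q \<noteq> 0" "poly_act f q c = 0"
      using annihilator_vector[OF f U, of c] insert by auto
    have "poly_act f (p * q) c = 0" using q(2) by (simp add: poly_act_mult[OF f] lin_0[OF lin_poly_act[OF f]])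
    moreover have "poly_act f (p * q) b = 0" if "b \<in> C" for b
      using p(2) that unfolding mult.commute[of p] by (simp add: poly_act_mult[OF f] lin_0[OF lin_poly_act[OF f]])
    ultimately show ?case using p(1) q(1) by (intro exI[of _ "p * q"]) auto
  qed
  from this[OF B(1)] obtain p where p: "p \<noteq> 0" "\<forall>b\<in>B. poly_act f p b = 0"
    using B(2) span_superset by blast
  have "poly_act f p u = 0" if "u \<in> U" for u
    using that unfolding B(2)[symmetric]
    by (induction rule: span_induct_alt)
      (use p(2) in \<open>auto simp: lin_add[OF lin_poly_act[OF f]] lin_scale[OF lin_poly_act[OF f]] lin_0[OF lin_poly_act[OF f]]\<close>)
  then show ?thesis using that p(1) by blast
qed

text \<open>A form of Fitting's lemma. An annihilating polynomial is \<open>X^k q\<close> with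
  \<open>q(0) = a\<close> nonzero, so \<open>q = a (1 - X r)\<close> and
  \<open>f^k (1 - f r(f)) = 0\<close> on \<open>U\<close>. The exponent is raised by one to be
  positive, as the power of \<open>x\<close> in \<open>low_rank_full\<close> requires.\<close>

lemma strongly_pi_regular:
  assumes f: "lin f" and U: "fin_dim U" "subspace U" "f ` U \<subseteq> U"
  obtains k p where "\<And>u. u \<in> U \<Longrightarrow> (f ^^ Suc k) (u - f (poly_act f p u)) = 0"
proof -
  obtain p where p: "p \<noteq> 0" "\<And>u. u \<in> U \<Longrightarrow> poly_act f p u = 0"
    using annihilator_subspace[OF assms] by blast
  obtain q where q: "p = [:- 0, 1:] ^ order 0 p * q" "\<not> [:- 0, 1:] dvd q"
    using order_decomp[OF p(1)] by blast
  obtain a q' where q': "q = pCons a q'" by (cases q) auto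
  have a: "a \<noteq> 0"
  proof
    assume "a = 0"
    then have "q = [:- 0, 1:] * q'" using q' by simp
    then show False using q(2) dvd_triv_left by metis
  qed
  have q2: "q = smult a (1 - [:0, 1:] * smult (- 1 / a) q')"
  proof -
    have "smult a (1 - [:0, 1:] * smult (- 1 / a) q') = [:a:] - pCons 0 (smult a (smult (- 1 / a) q'))"
      by (simp add: smult_diff_right)
    also have "smult a (smult (- 1 / a) q') = - q'" using a by simp
    finally show ?thesis by (simp add: q')
  qed
  let ?k = "order 0 p" and ?r = "smult (- 1 / a) q'"
  have "(f ^^ Suc ?k) (u - f (poly_act f ?r u)) = 0" if "u \<in> U" for u
  proof -
    have "[:0, 1:] ^ ?k = monom (1::'a) ?k" by (simp add: monom_altdef)
    then have "p = monom 1 ?k * smult a (1 - [:0, 1:] * ?r)" using q(1) q2 by simp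
    from arg_cong[OF this, of "\<lambda>p. poly_act f p u"]
    have "0 = scale a ((f ^^ ?k) (poly_act f (1 - [:0, 1:] * ?r) u))"
      unfolding p(2)[OF that] poly_act_mult[OF f] poly_act_monom poly_act_smult
      by (simp only: scale_one lin_scale[OF lin_funpow[OF f]])
    moreover have "poly_act f (1 - [:0, 1:] * ?r) u = u - f (poly_act f ?r u)"
      by (simp only: poly_act_diff poly_act_1 poly_act_mult[OF f] poly_act_pCons[OF f] poly_act_0
          lin_0[OF f] scale_zero_left scale_one add_0_left add_0_right)
    ultimately have "(f ^^ ?k) (u - f (poly_act f ?r u)) = 0" using a by simp
    then show ?thesis by (simp add: lin_0[OF f])
  qed
  then show ?thesis by (rule that)
qed

section \<open>Stable subspaces, irreducibility, generated algebras and two-sided ideals\<close>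

definition stable :: "('v \<Rightarrow> 'v) set \<Rightarrow> 'v set \<Rightarrow> bool" where
  "stable R W \<longleftrightarrow> (\<forall>f\<in>R. f ` W \<subseteq> W)"

definition irreducible_on :: "('v \<Rightarrow> 'v) set \<Rightarrow> 'v set \<Rightarrow> bool" where
  "irreducible_on R U \<longleftrightarrow> (\<forall>W. subspace W \<and> W \<subseteq> U \<and> stable R W \<longrightarrow> W = {0} \<or> W = U)"

lemma irreducible_onD:
  "irreducible_on R U \<Longrightarrow> subspace W \<Longrightarrow> W \<subseteq> U \<Longrightarrow> stable R W \<Longrightarrow> w \<in> W \<Longrightarrow> w \<noteq> 0 \<Longrightarrow> W = U"
  unfolding irreducible_on_def by blast

text \<open>The unital algebra generated by \<open>R\<close>. Products grow only by a generator on
  the left, which keeps inductions simple; closure under composition is \<open>alg_comp\<close>, for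
  linear generators.\<close>

inductive_set alg :: "('v \<Rightarrow> 'v) set \<Rightarrow> ('v \<Rightarrow> 'v) set" for R where
  alg_id: "id \<in> alg R"
| alg_step: "h \<in> alg R \<Longrightarrow> f \<in> R \<Longrightarrow> f \<circ> h \<in> alg R"
| alg_plus: "h \<in> alg R \<Longrightarrow> h' \<in> alg R \<Longrightarrow> (\<lambda>v. h v + h' v) \<in> alg R"
| alg_scale: "h \<in> alg R \<Longrightarrow> (\<lambda>v. scale c (h v)) \<in> alg R"

lemma alg_base: "f \<in> R \<Longrightarrow> f \<in> alg R"
  using alg_step[OF alg_id] by (metis comp_id)

lemma alg_lin: "h \<in> alg R \<Longrightarrow> \<forall>f\<in>R. lin f \<Longrightarrow> lin h"
  by (induction rule: alg.induct) (auto intro: lin_id lin_comp lin_plus lin_smult)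

lemma alg_stable: "h \<in> alg R \<Longrightarrow> stable R W \<Longrightarrow> subspace W \<Longrightarrow> w \<in> W \<Longrightarrow> h w \<in> W"
proof (induction arbitrary: w rule: alg.induct)
  case (alg_step h f)
  then show ?case unfolding stable_def by (auto simp: image_subset_iff)
qed (auto intro: subspace_add subspace_scale)

lemma alg_comp:
  assumes "\<forall>f\<in>R. lin f" "g \<in> alg R" "h \<in> alg R"
  shows "g \<circ> h \<in> alg R"
  using assms(2)
proof (induction rule: alg.induct)
  case alg_id
  show ?case using assms(3) by simp
next
  case (alg_step h' f)
  then show ?case by (metis alg.alg_step comp_assoc)
next
  case (alg_plus h1 h2)
  then show ?case using alg.alg_plus[OF alg_plus(3,4)] by (simp add: comp_def)
next
  case (alg_scale h' c)
  then show ?case using alg.alg_scale[OF alg_scale(2)] by (simp add: comp_def)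
qed

lemma alg_minus:
  assumes "g \<in> alg R" "h \<in> alg R" shows "(\<lambda>v. g v - h v) \<in> alg R"
  using alg_plus[OF assms(1) alg_scale[OF assms(2), of "-1"]] by simp

lemma alg_funpow:
  assumes "\<forall>f\<in>R. lin f" "g \<in> alg R" shows "g ^^ k \<in> alg R"
proof (induction k)
  case (Suc k)
  then show ?case unfolding funpow.simps by (intro alg_comp assms)
qed (unfold funpow.simps, rule alg_id)

lemma alg_zero: "(\<lambda>v. 0) \<in> alg R"
  using alg_scale[OF alg_id, of 0] by simp

lemma alg_sum: "(\<And>i. i \<in> I \<Longrightarrow> h i \<in> alg R) \<Longrightarrow> (\<lambda>v. \<Sum>i\<in>I. h i v) \<in> alg R"
  by (induction I rule: infinite_finite_induct) (auto intro: alg_zero alg_plus)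

lemma alg_poly_act:
  assumes "\<forall>f\<in>R. lin f" "g \<in> alg R" shows "poly_act g p \<in> alg R"
  unfolding poly_act_def[abs_def] by (intro alg_sum alg_scale alg_funpow assms)

inductive_set ideal_gen :: "('v \<Rightarrow> 'v) set \<Rightarrow> ('v \<Rightarrow> 'v) \<Rightarrow> ('v \<Rightarrow> 'v) set" for R z where
  ideal_base: "a \<in> alg R \<Longrightarrow> b \<in> alg R \<Longrightarrow> a \<circ> z \<circ> b \<in> ideal_gen R z"
| ideal_plus: "h \<in> ideal_gen R z \<Longrightarrow> h' \<in> ideal_gen R z \<Longrightarrow> (\<lambda>v. h v + h' v) \<in> ideal_gen R z"
| ideal_scale: "h \<in> ideal_gen R z \<Longrightarrow> (\<lambda>v. scale c (h v)) \<in> ideal_gen R z"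

lemma ideal_self: "z \<in> ideal_gen R z"
  using ideal_base[OF alg_id alg_id] by simp

lemma ideal_alg:
  assumes "\<forall>f\<in>R. lin f" "z \<in> alg R" "h \<in> ideal_gen R z" shows "h \<in> alg R"
  using assms(3) by induction (intro alg_comp alg_plus alg_scale assms; assumption)+

lemma ideal_mult_left:
  assumes R: "\<forall>f\<in>R. lin f" and g: "g \<in> alg R" and h: "h \<in> ideal_gen R z"
  shows "g \<circ> h \<in> ideal_gen R z"
  using h
proof induction
  case (ideal_base a b)
  then show ?case using ideal_gen.ideal_base[OF alg_comp[OF R g ideal_base(1)]] by (metis comp_assoc)
next
  case (ideal_plus h h')
  then show ?case using ideal_gen.ideal_plus[OF ideal_plus(3,4)] alg_lin[OF g R]
    by (simp add: comp_def lin_add)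
next
  case (ideal_scale h c)
  then show ?case using ideal_gen.ideal_scale[OF ideal_scale(2)] alg_lin[OF g R]
    by (simp add: comp_def lin_scale)
qed

lemma ideal_mult_right:
  assumes R: "\<forall>f\<in>R. lin f" and g: "g \<in> alg R" and h: "h \<in> ideal_gen R z"
  shows "h \<circ> g \<in> ideal_gen R z"
  using h
proof induction
  case (ideal_base a b)
  then show ?case using ideal_gen.ideal_base[OF ideal_base(1) alg_comp[OF R ideal_base(2) g]]
    by (metis comp_assoc)
next
  case (ideal_plus h h')
  then show ?case using ideal_gen.ideal_plus[OF ideal_plus(3,4)] by (simp add: comp_def)
next
  case (ideal_scale h c)
  then show ?case using ideal_gen.ideal_scale[OF ideal_scale(2)] by (simp add: comp_def)
qed

lemma ideal_minus:
  assumes "g \<in> ideal_gen R z" "h \<in> ideal_gen R z" shows "(\<lambda>v. g v - h v) \<in> ideal_gen R z"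
  using ideal_plus[OF assms(1) ideal_scale[OF assms(2), of "-1"]] by simp

lemma ideal_zero: "(\<lambda>v. 0) \<in> ideal_gen R z"
  using ideal_scale[OF ideal_self, of 0] by simp

text \<open>This is the induction step of the Jacobson density theorem.\<close>

lemma separating_functionals:
  fixes \<Phi> :: "('v \<Rightarrow> 'a) set"
  assumes comb: "\<And>\<phi> \<psi> k. \<phi> \<in> \<Phi> \<Longrightarrow> \<psi> \<in> \<Phi> \<Longrightarrow> (\<lambda>v. \<phi> v - k * \<psi> v) \<in> \<Phi>"
    and lin: "\<And>\<phi> u v k. \<phi> \<in> \<Phi> \<Longrightarrow> \<phi> (u - scale k v) = \<phi> u - k * \<phi> v"
    and W: "subspace W"
    and sep: "\<And>v. v \<in> W \<Longrightarrow> (\<And>\<phi>. \<phi> \<in> \<Phi> \<Longrightarrow> \<phi> v = 0) \<Longrightarrow> v = 0"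
    and "finite C" "C \<subseteq> W" "v \<in> W"
    and van: "\<And>\<phi>. \<phi> \<in> \<Phi> \<Longrightarrow> (\<And>c. c \<in> C \<Longrightarrow> \<phi> c = 0) \<Longrightarrow> \<phi> v = 0"
  shows "v \<in> span C"
  using assms(5-8)
proof (induction C arbitrary: v)
  case empty
  then show ?case using sep by simp
next
  case (insert c C)
  show ?case
  proof (cases "\<exists>\<phi>\<in>\<Phi>. (\<forall>d\<in>C. \<phi> d = 0) \<and> \<phi> c \<noteq> 0")
    case False
    have "\<phi> v = 0" if "\<phi> \<in> \<Phi>" "\<And>d. d \<in> C \<Longrightarrow> \<phi> d = 0" for \<phi>
      using insert.prems(3)[of \<phi>] that False by blast
    then have "v \<in> span C" using insert.IH insert.prems(1,2) by blast
    then show ?thesis using span_mono[of C "insert c C"] by blast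
  next
    case True
    then obtain \<phi> where \<phi>: "\<phi> \<in> \<Phi>" "\<And>d. d \<in> C \<Longrightarrow> \<phi> d = 0" "\<phi> c \<noteq> 0" by blast
    let ?k = "\<phi> v / \<phi> c"
    have "v - scale ?k c \<in> span C"
    proof (rule insert.IH)
      show "C \<subseteq> W" "v - scale ?k c \<in> W"
        using insert.prems W by (auto intro: subspace_diff subspace_scale)
      fix \<chi> assume \<chi>: "\<chi> \<in> \<Phi>" "\<And>d. d \<in> C \<Longrightarrow> \<chi> d = 0"
      \<comment> \<open>Subtracting \<open>?l\<close> times \<open>\<phi>\<close> makes
        \<open>\<chi>\<close> vanish at \<open>c\<close> as well, hence on \<open>insert c C\<close>
        and therefore at \<open>v\<close>.\<close>
      let ?l = "\<chi> c / \<phi> c"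
      have "\<chi> v - ?l * \<phi> v = 0"
        by (rule insert.prems(3)[OF comb[OF \<chi>(1) \<phi>(1)]]) (use \<chi> \<phi> in auto)
      then show "\<chi> (v - scale ?k c) = 0" using lin[OF \<chi>(1)] by simp
    qed
    then have "v - scale ?k c + scale ?k c \<in> span (insert c C)"
      by (meson insertI1 span_add span_base span_mono span_scale subset_insertI subsetD)
    then show ?thesis by simp
  qed
qed

end

section \<open>Eigenvectors over an algebraically closed field\<close>

locale alg_closed_space = endo_space scale
  for scale :: "'a::alg_closed_field \<Rightarrow> 'v::ab_group_add \<Rightarrow> 'v"
begin

text \<open>A nonzero polynomial of least degree that kills \<open>u\<close> has a root
  \<open>l\<close>; dividing by \<open>X - l\<close> gives \<open>q\<close> with
  \<open>q(f) u\<close> nonzero by minimality, and this vector is an eigenvector.\<close>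

lemma eigenvector_on:
  assumes f: "lin f" and U: "fin_dim U" "subspace U" "f ` U \<subseteq> U" and u: "u \<in> U" "u \<noteq> 0"
  obtains v l where "v \<in> U" "v \<noteq> 0" "f v = scale l v"
proof -
  let ?P = "\<lambda>p. p \<noteq> 0 \<and> poly_act f p u = 0"
  obtain p where p: "?P p" and min: "\<And>q. ?P q \<Longrightarrow> degree p \<le> degree q"
    using ex_has_least_nat[of ?P _ degree] annihilator_vector[OF f U u(1)] by blast
  have "degree p \<noteq> 0"
  proof
    assume "degree p = 0"
    then obtain c where "p = [:c:]" by (rule degree_eq_zeroE)
    then show False using p u(2) by (simp add: poly_act_pCons[OF f] lin_0[OF f])
  qed
  then obtain l where "poly p l = 0" using alg_closed_imp_poly_has_root by blast
  then obtain q where q: "p = [:- l, 1:] * q" using poly_eq_0_iff_dvd by blast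
  have "q \<noteq> 0" using p q by auto
  then have "degree q < degree p" unfolding q by (subst degree_mult_eq) auto
  then have "poly_act f q u \<noteq> 0" using min[of q] \<open>q \<noteq> 0\<close> by auto
  moreover have "f (poly_act f q u) = scale l (poly_act f q u)"
  proof -
    have "poly_act f ([:- l, 1:] * q) u = 0" using p q by simp
    then show ?thesis unfolding poly_act_mult[OF f] by (simp add: poly_act_pCons[OF f] lin_0[OF f])
  qed
  ultimately show ?thesis using that poly_act_in[OF U(2,3) u(1)] by blast
qed

end

section \<open>Density\<close>

context endo_space
begin

text \<open>\<open>c\<close> is the coordinate at \<open>v\<close> with respect to a basis of the
  whole space that extends a basis of \<open>W\<close> together with \<open>v\<close>.\<close>

lemma exists_functional:
  assumes "subspace W" "v \<notin> W"
  obtains c :: "'v \<Rightarrow> 'a" where "\<And>x y. c (x + y) = c x + c y" "\<And>k x. c (scale k x) = k * c x"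
    "\<And>x. x \<in> W \<Longrightarrow> c x = 0" "c v = 1"
proof -
  obtain B where B: "B \<subseteq> W" "indep B" "W \<subseteq> span B" by (rule maximal_independent_subset)
  have "v \<notin> span B" using assms span_minimal[OF B(1)] by blast
  then have ind: "indep (insert v B)" using B(2) by (rule independent_insertI)
  have "v \<notin> B" using \<open>v \<notin> span B\<close> span_base by blast
  let ?E = "extend_basis (insert v B)"
  have E: "indep ?E" "insert v B \<subseteq> ?E" "span ?E = UNIV"
    using independent_extend_basis[OF ind] extend_basis_superset[OF ind] span_extend_basis[OF ind] by auto
  define c where "c x = representation ?E x v" for x
  have add: "c (x + y) = c x + c y" for x y
    unfolding c_def using E by (simp add: representation_add)
  have scl: "c (scale k x) = k * c x" for k x
    unfolding c_def using E by (simp add: representation_scale)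
  have basis: "c b = (if v = b then 1 else 0)" if "b \<in> insert v B" for b
    unfolding c_def using E that by (subst representation_basis) auto
  have "c x = 0" if "x \<in> span B" for x
    using that
  proof (induction rule: span_induct_alt)
    case base
    show ?case using scl[of 0 0] by simp
  next
    case (step k b y)
    then show ?case using basis[of b] \<open>v \<notin> B\<close> by (auto simp: add scl)
  qed
  then have "c x = 0" if "x \<in> W" for x using that B(3) by blast
  moreover have "c v = 1" using basis by simp
  ultimately show ?thesis using that[of c, OF add scl] by blast
qed

lemma exists_functional_1:
  assumes "v \<noteq> 0"
  obtains c :: "'v \<Rightarrow> 'a" where "\<And>x y. c (x + y) = c x + c y" "\<And>k x. c (scale k x) = k * c x" "c v = 1"
  by (rule exists_functional[of "{0}" v]) (use assms that in auto)

text \<open>The orbit of \<open>w\<close> under \<open>alg R\<close> is a stable subspace of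
  \<open>W\<close> that contains \<open>w\<close>, so it is all of \<open>W\<close>.\<close>

lemma irreducible_transitive:
  assumes R: "\<forall>f\<in>R. lin f" and W: "subspace W" "stable R W" "irreducible_on R W"
    and w: "w \<in> W" "w \<noteq> 0" and u: "u \<in> W"
  obtains b where "b \<in> alg R" "b w = u"
proof -
  let ?X = "(\<lambda>b. b w) ` alg R"
  have "subspace ?X"
    unfolding subspace_def
  proof (intro conjI allI ballI)
    show "0 \<in> ?X" using alg_zero by (intro image_eqI[of _ _ "\<lambda>v. 0"]) auto
  next
    fix x y assume "x \<in> ?X" "y \<in> ?X"
    then obtain a b where "a \<in> alg R" "b \<in> alg R" "x = a w" "y = b w" by blast
    then show "x + y \<in> ?X" by (intro image_eqI[OF _ alg_plus[of a R b]]) auto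
  next
    fix c x assume "x \<in> ?X"
    then obtain a where "a \<in> alg R" "x = a w" by blast
    then show "scale c x \<in> ?X" by (intro image_eqI[OF _ alg_scale[of a R c]]) auto
  qed
  moreover have "?X \<subseteq> W" using alg_stable W w by blast
  moreover have "stable R ?X"
    unfolding stable_def
  proof safe
    fix f b assume "f \<in> R" "b \<in> alg R"
    then show "f (b w) \<in> ?X" by (intro image_eqI[OF _ alg_step[of b R f]]) auto
  qed
  moreover have "w \<in> ?X" by (rule image_eqI[OF _ alg_id]) simp
  ultimately have "?X = W" using irreducible_onD[OF W(3)] w(2) by blast
  then show ?thesis using that u by blast
qed

text \<open>For an \<open>h\<close> acting as the identity on \<open>D\<close> this yields
  \<open>D \<subseteq> N\<close>; with \<open>N = {0}\<close> it shows that \<open>g\<close> cannot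
  vanish on a nonzero \<open>D\<close>.\<close>

lemma ideal_maps:
  assumes R: "\<forall>f\<in>R. lin f" and h: "h \<in> ideal_gen R g"
    and D: "subspace D" "stable R D" and N: "subspace N" "stable R N"
    and g: "g ` D \<subseteq> N" and x: "x \<in> D"
  shows "h x \<in> N"
  using h
proof induction
  case (ideal_base a b)
  have "g (b x) \<in> N" using alg_stable[OF ideal_base(2) D(2,1) x] g by blast
  then show ?case using alg_stable[OF ideal_base(1) N(2,1)] by simp
qed (auto intro: subspace_add subspace_scale N)

text \<open>Elements of the algebra are functions on the whole type, but equalities are known only
  on \<open>U\<close>; this carries ideal membership across agreement on \<open>U\<close>.\<close>

lemma ideal_cong_on:
  assumes R: "\<forall>f\<in>R. lin f" and U: "subspace U" "stable R U"
    and h: "h \<in> ideal_gen R y" and y': "y' \<in> ideal_gen R z" "\<And>u. u \<in> U \<Longrightarrow> y' u = y u"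
  shows "\<exists>h'\<in>ideal_gen R z. \<forall>u\<in>U. h' u = h u"
  using h
proof induction
  case (ideal_base a b)
  have "a \<circ> y' \<circ> b \<in> ideal_gen R z"
    by (intro ideal_mult_left[OF R] ideal_mult_right[OF R] ideal_base y')
  moreover have "(a \<circ> y' \<circ> b) u = (a \<circ> y \<circ> b) u" if "u \<in> U" for u
    using y'(2) alg_stable[OF ideal_base(2) U(2,1) that] by simp
  ultimately show ?case by blast
next
  case (ideal_plus h1 h2)
  then obtain h1' h2' where h': "h1' \<in> ideal_gen R z" "h2' \<in> ideal_gen R z"
    and eq: "\<forall>u\<in>U. h1' u = h1 u" "\<forall>u\<in>U. h2' u = h2 u" by blast
  show ?case by (rule bexI[OF _ ideal_gen.ideal_plus[OF h']]) (use eq in auto)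
next
  case (ideal_scale h1 c)
  then obtain h1' where h': "h1' \<in> ideal_gen R z" and eq: "\<forall>u\<in>U. h1' u = h1 u" by blast
  show ?case by (rule bexI[OF _ ideal_gen.ideal_scale[OF h']]) (use eq in auto)
qed

end

context alg_closed_space
begin

text \<open>Burnside's theorem in relative form; \<open>z = id\<close> is the usual one. An element
  of the ideal of least nonzero rank on \<open>W\<close> has rank one, and sums of its multiples by
  \<open>alg R\<close> on both sides produce every endomorphism of \<open>W\<close>.\<close>

lemma density:
  assumes R: "\<forall>f\<in>R. lin f" and W: "fin_dim W" "subspace W" "stable R W" "irreducible_on R W"
    and z: "z \<in> alg R" "w0 \<in> W" "z w0 \<noteq> 0" and f: "lin f" "f ` W \<subseteq> W"
  obtains h where "h \<in> ideal_gen R z" "\<And>w. w \<in> W \<Longrightarrow> h w = f w"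
proof -
  let ?P = "\<lambda>t. t \<in> ideal_gen R z \<and> (\<exists>w\<in>W. t w \<noteq> 0)"
  have "?P z" using ideal_self z by blast
  then obtain t where t: "?P t" and min: "\<And>s. ?P s \<Longrightarrow> dim (t ` W) \<le> dim (s ` W)"
    using ex_has_least_nat[of ?P z "\<lambda>t. dim (t ` W)"] by blast
  obtain v0 where v0: "v0 \<in> W" "t v0 \<noteq> 0" using t by blast
  define w' where "w' = t v0"
  have t_alg: "t \<in> alg R" using ideal_alg[OF R z(1)] t by blast
  have t_lin: "lin t" using alg_lin[OF t_alg R] .
  have tW: "t w \<in> W" if "w \<in> W" for w using alg_stable[OF t_alg W(3,2) that] .
  have w': "w' \<in> W" "w' \<noteq> 0" using tW v0 unfolding w'_def by auto
  \<comment> \<open>If \<open>t v\<close> is not a multiple of \<open>w'\<close>, take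
    \<open>b w' = v\<close>. On the image of \<open>t\<close> the map \<open>t b\<close> has an
    eigenvalue \<open>l\<close>, so \<open>(t b - l) t\<close> has smaller rank, yet it sends
    \<open>v0\<close> to \<open>t v - l w'\<close>, which is nonzero.\<close>
  have rank1: "t v \<in> span {w'}" if v: "v \<in> W" for v
  proof (rule ccontr)
    assume notin: "t v \<notin> span {w'}"
    obtain b where b: "b \<in> alg R" "b w' = v"
      by (rule irreducible_transitive[OF R W(2-4) w' v])
    have b_lin: "lin b" using alg_lin[OF b(1) R] .
    let ?Y = "t ` W" and ?g = "t \<circ> b"
    have Y: "fin_dim ?Y" "subspace ?Y"
      using fin_dim_image[OF t_lin W(1)] subspace_image[OF t_lin W(2)] by auto
    have g_lin: "lin ?g" using lin_comp[OF t_lin b_lin] .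
    have "?g ` ?Y \<subseteq> ?Y" using tW alg_stable[OF b(1) W(3,2)] by auto
    moreover have "w' \<in> ?Y" using v0 unfolding w'_def by blast
    ultimately obtain y l where y: "y \<in> ?Y" "y \<noteq> 0" "?g y = scale l y"
      using eigenvector_on[OF g_lin Y _ _ w'(2)] by blast
    let ?d = "\<lambda>v. ?g v - scale l v"
    let ?h = "\<lambda>v. (?g \<circ> t) v - scale l (t v)"
    have "?h \<in> ideal_gen R z"
      using t ideal_minus[OF ideal_mult_left[OF R alg_comp[OF R t_alg b(1)]] ideal_scale] by blast
    moreover have "?h v0 \<noteq> 0"
    proof
      assume "?h v0 = 0"
      then have "t v = scale l w'" using b(2) unfolding w'_def by simp
      then show False using notin by (simp add: span_scale span_base)
    qed
    ultimately have "dim ?Y \<le> dim (?h ` W)" using min v0(1) by blast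
    also have "?h ` W = ?d ` ?Y" by (auto simp: image_image)
    also have "dim (?d ` ?Y) < dim ?Y"
      using y by (intro dim_image_less[OF lin_minus[OF g_lin lin_smult[OF lin_id(2)]] Y y(1)]) auto
    finally show False by simp
  qed
  obtain c :: "'v \<Rightarrow> 'a" where c: "\<And>x y. c (x + y) = c x + c y" "\<And>k x. c (scale k x) = k * c x" "c w' = 1"
    using exists_functional_1[OF w'(2)] by blast
  have c_diff: "c (x - scale k y) = c x - k * c y" for x y k
    using c(1)[of x "scale (- k) y"] c(2)[of "- k" y] by simp
  have t_eq: "t v = scale (c (t v)) w'" if "v \<in> W" for v
    using rank1[OF that] c(2,3) by (auto simp: span_singleton)
  \<comment> \<open>Each functional moves a vector by the algebra and reads off the coordinate of
    its image under the rank-one map \<open>t\<close>. They are closed under combinations because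
    \<open>alg R\<close> is, and separate points because \<open>W\<close> is irreducible.\<close>
  define \<Phi> where "\<Phi> = (\<lambda>b v. c (t (b v))) ` alg R"
  obtain B where B: "finite B" "indep B" "span B = W" by (rule fin_dim_basis[OF W(1,2)])
  have BW: "B \<subseteq> W" using B(3) span_superset by blast
  have unit: "\<exists>h\<in>ideal_gen R z. h b0 = u \<and> (\<forall>b\<in>B - {b0}. h b = 0)" if b0: "b0 \<in> B" and u: "u \<in> W" for b0 u
  proof -
    have "b0 \<notin> span (B - {b0})" using B(2) b0 dependent_def by blast
    \<comment> \<open>Otherwise \<open>separating_functionals\<close> would put \<open>b0\<close>
      into the span of the other basis vectors.\<close>
    have "\<exists>\<chi>\<in>\<Phi>. (\<forall>b\<in>B - {b0}. \<chi> b = 0) \<and> \<chi> b0 \<noteq> 0"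
    proof (rule ccontr)
      assume no: "\<not> ?thesis"
      have "b0 \<in> span (B - {b0})"
      proof (rule separating_functionals[of \<Phi> W])
        fix \<phi> \<psi> k assume "\<phi> \<in> \<Phi>" "\<psi> \<in> \<Phi>"
        then obtain a b where ab: "a \<in> alg R" "b \<in> alg R" "\<phi> = (\<lambda>v. c (t (a v)))" "\<psi> = (\<lambda>v. c (t (b v)))"
          unfolding \<Phi>_def by auto
        have alg: "(\<lambda>v. a v - scale k (b v)) \<in> alg R" by (intro alg_minus alg_scale ab)
        have eq: "(\<lambda>v. \<phi> v - k * \<psi> v) = (\<lambda>v. c (t (a v - scale k (b v))))"
          by (simp add: ab lin_diff[OF t_lin] lin_scale[OF t_lin] c_diff)
        show "(\<lambda>v. \<phi> v - k * \<psi> v) \<in> \<Phi>"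
          unfolding \<Phi>_def eq by (rule image_eqI[OF _ alg]) simp
      next
        fix \<phi> u v k assume "\<phi> \<in> \<Phi>"
        then obtain a where a: "a \<in> alg R" "\<phi> = (\<lambda>v. c (t (a v)))"
          unfolding \<Phi>_def by auto
        show "\<phi> (u - scale k v) = \<phi> u - k * \<phi> v"
          using alg_lin[OF a(1) R]
          by (simp add: a(2) lin_diff lin_scale lin_diff[OF t_lin] lin_scale[OF t_lin] c_diff)
      next
        fix v assume v: "v \<in> W" and all: "\<And>\<phi>. \<phi> \<in> \<Phi> \<Longrightarrow> \<phi> v = 0"
        show "v = 0"
        proof (rule ccontr)
          assume "v \<noteq> 0"
          then obtain b where b: "b \<in> alg R" "b v = v0"
            using irreducible_transitive[OF R W(2-4) v _ v0(1)] by blast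
          have "(\<lambda>v. c (t (b v))) \<in> \<Phi>" unfolding \<Phi>_def using b(1) by (rule imageI)
          from all[OF this] show False using b(2) c(3) unfolding w'_def by simp
        qed
      next
        show "\<phi> b0 = 0" if "\<phi> \<in> \<Phi>" "\<And>b. b \<in> B - {b0} \<Longrightarrow> \<phi> b = 0" for \<phi>
          using no that by blast
        show "subspace W" "finite (B - {b0})" "B - {b0} \<subseteq> W" "b0 \<in> W"
          using W(2) B(1) BW b0 by auto
      qed
      then show False using \<open>b0 \<notin> span (B - {b0})\<close> by blast
    qed
    then obtain \<chi> where \<chi>: "\<chi> \<in> \<Phi>" "\<forall>b\<in>B - {b0}. \<chi> b = 0" "\<chi> b0 \<noteq> 0" by blast
    then obtain b where b: "b \<in> alg R" "\<chi> = (\<lambda>v. c (t (b v)))" unfolding \<Phi>_def by auto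
    obtain a where a: "a \<in> alg R" "a w' = u"
      by (rule irreducible_transitive[OF R W(2-4) w' u])
    define h where "h = (\<lambda>v. scale (1 / \<chi> b0) ((a \<circ> t \<circ> b) v))"
    have h: "h \<in> ideal_gen R z"
      unfolding h_def using t a b by (intro ideal_scale ideal_mult_left[OF R] ideal_mult_right[OF R]) auto
    have hv: "h v = scale (\<chi> v / \<chi> b0) u" if "v \<in> W" for v
    proof -
      have "t (b v) = scale (\<chi> v) w'"
        using t_eq alg_stable[OF b(1) W(3,2) that] unfolding b(2) by blast
      then show ?thesis using a(2) lin_scale[OF alg_lin[OF a(1) R]] by (simp add: h_def)
    qed
    have "h b0 = u" using hv[of b0] \<chi>(3) b0 BW by auto
    moreover have "h b' = 0" if "b' \<in> B - {b0}" for b' using hv[of b'] \<chi>(2) that BW by auto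
    ultimately show ?thesis using h by blast
  qed
  have "\<exists>h\<in>ideal_gen R z. (\<forall>b\<in>C. h b = f b) \<and> (\<forall>b\<in>B - C. h b = 0)" if "finite C" "C \<subseteq> B" for C
    using that
  proof (induction C)
    case empty
    show ?case by (rule bexI[OF _ ideal_zero]) auto
  next
    case (insert b0 C)
    then obtain h where h: "h \<in> ideal_gen R z" "\<forall>b\<in>C. h b = f b" "\<forall>b\<in>B - C. h b = 0" by auto
    have "f b0 \<in> W" using insert BW f(2) by auto
    then obtain k where k: "k \<in> ideal_gen R z" "k b0 = f b0" "\<forall>b\<in>B - {b0}. k b = 0"
      using unit[of b0 "f b0"] insert by auto
    show ?case by (rule bexI[OF _ ideal_plus[OF h(1) k(1)]]) (use h k insert in auto)
  qed
  from this[OF B(1)] obtain h where h: "h \<in> ideal_gen R z" "\<forall>b\<in>B. h b = f b" by blast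
  have h_lin: "lin h" using alg_lin[OF ideal_alg[OF R z(1) h(1)] R] .
  have "h w = f w" if "w \<in> W" for w
    using that unfolding B(3)[symmetric]
    by (induction rule: span_induct_alt)
      (use h(2) in \<open>auto simp: lin_add[OF h_lin] lin_scale[OF h_lin] lin_0[OF h_lin]
        lin_add[OF f(1)] lin_scale[OF f(1)] lin_0[OF f(1)]\<close>)
  then show ?thesis using that h(1) by blast
qed

text \<open>The element \<open>e\<close> of minimal rank lies in every ideal that does not vanish on \<open>W\<close>. In
  its ideal, \<open>x\<close> acts on \<open>W\<close> as an idempotent of rank \<open>dim W - 1\<close>, and \<open>g = 1 - x p(x)\<close> is annihilated by
  a power of \<open>x\<close>. Since \<open>g\<close> does not vanish on \<open>W\<close>, its ideal contains \<open>e\<close>, hence \<open>x\<close>, hence \<open>1\<close>. The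
  rank of that power of \<open>x\<close> exceeds \<open>dim W - 1\<close>, for otherwise there would be an element of rank one.\<close>

lemma low_rank_full:
  assumes R: "\<forall>f\<in>R. lin f" and U: "fin_dim U" "subspace U" "stable R U"
    and W: "subspace W" "W \<subseteq> U" "stable R W" "irreducible_on R W" "2 \<le> dim W"
    and no_rank1: "\<And>t w. t \<in> alg R \<Longrightarrow> w \<in> W \<Longrightarrow> t w \<noteq> 0 \<Longrightarrow> dim (t ` U) \<noteq> 1"
  obtains g h where "g \<in> alg R" "dim (g ` U) + dim W \<le> dim U" "h \<in> ideal_gen R g" "\<And>u. u \<in> U \<Longrightarrow> h u = u"
proof -
  have Wf: "fin_dim W" using fin_dim_mono[OF U(1) W(2)] .
  have "W \<noteq> {0}" using dim_eq_0_fin_dim[OF Wf W(1)] W(5) by auto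
  then obtain b0 where b0: "b0 \<in> W" "b0 \<noteq> 0" using subspace_0[OF W(1)] by blast
  \<comment> \<open>Asking for a fixed vector in \<open>W\<close>, and not just a nonzero action
    there, keeps \<open>?P\<close> valid for \<open>s \<circ> s\<close>, to which minimality is
    applied below.\<close>
  let ?P = "\<lambda>e. e \<in> alg R \<and> (\<exists>w\<in>W. w \<noteq> 0 \<and> e w = w)"
  have "?P id" using alg_id b0 by auto
  then obtain e where e: "?P e" and min: "\<And>s. ?P s \<Longrightarrow> dim (e ` U) \<le> dim (s ` U)"
    using ex_has_least_nat[of ?P id "\<lambda>t. dim (t ` U)"] by blast
  obtain w2 where w2: "w2 \<in> W" "w2 \<noteq> 0" "e w2 = w2" using e by blast
  have e_lin: "lin e" using alg_lin e R by blast
  have algU: "a u \<in> U" if "a \<in> alg R" "u \<in> U" for a u using alg_stable[OF that(1) U(3,2) that(2)] .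
  have algW: "a u \<in> W" if "a \<in> alg R" "u \<in> W" for a u using alg_stable[OF that(1) W(3,1) that(2)] .
  have eU: "subspace (e ` U)" "fin_dim (e ` U)"
    using subspace_image[OF e_lin U(2)] fin_dim_image[OF e_lin U(1)] by auto
  have e_in: "\<exists>h\<in>ideal_gen R z. \<forall>u\<in>U. h u = e u" if z: "z \<in> alg R" "w1 \<in> W" "z w1 \<noteq> 0" for z w1
  proof -
    obtain y' where y': "y' \<in> alg R" "y' w2 = w1"
      by (rule irreducible_transitive[OF R W(1,3,4) w2(1,2) z(2)])
    obtain y where y: "y \<in> alg R" "y (z w1) = w2"
      by (rule irreducible_transitive[OF R W(1,3,4) algW[OF z(1,2)] z(3) w2(1)])
    \<comment> \<open>\<open>y'\<close> carries \<open>w2\<close> to \<open>w1\<close> and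
      \<open>y\<close> carries \<open>z w1\<close> back to \<open>w2\<close>, so \<open>s\<close>
      fixes \<open>w2\<close>. Its image lies in that of \<open>e\<close>, and minimality makes
      \<open>s\<close> bijective on the image of \<open>e\<close>.\<close>
    define s where "s = (e \<circ> y) \<circ> z \<circ> (y' \<circ> e)"
    have s_ideal: "s \<in> ideal_gen R z"
      unfolding s_def using e y(1) y'(1) by (intro ideal_base alg_comp R) auto
    have s_alg: "s \<in> alg R" using ideal_alg[OF R z(1) s_ideal] .
    have s_lin: "lin s" using alg_lin[OF s_alg R] .
    have s_w2: "s w2 = w2" unfolding s_def using w2 y y' by simp
    have sU: "s u \<in> e ` U" if "u \<in> U" for u
    proof -
      have "e u \<in> U" using algU[OF _ that] e by blast
      then have "y (z (y' (e u))) \<in> U" using algU y(1) y'(1) z(1) by metis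
      then show ?thesis unfolding s_def by simp
    qed
    have "?P s" using s_alg s_w2 w2(1,2) by blast
    then have "dim (e ` U) \<le> dim (s ` U)" by (rule min)
    then have "s ` U = e ` U"
      using sU by (intro subspace_eqI_dim[OF eU(2,1) subspace_image[OF s_lin U(2)]]) auto
    have "(s \<circ> s) w2 = w2" using s_w2 by simp
    then have "?P (s \<circ> s)" using alg_comp[OF R s_alg s_alg] w2(1,2) by blast
    then have "dim (e ` U) \<le> dim ((s \<circ> s) ` U)" by (rule min)
    also have "(s \<circ> s) ` U = s ` (e ` U)" unfolding \<open>s ` U = e ` U\<close>[symmetric] by (rule image_comp[symmetric])
    finally have s_inj: "v = 0" if "v \<in> e ` U" "s v = 0" for v
      using inj_on_if_dim_image_eq[OF s_lin eU(2,1)] that by blast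
    have eU_U: "e ` U \<subseteq> U" using algU e by auto
    have pow_inj: "v = 0" if "v \<in> e ` U" "(s ^^ k) v = 0" for v k
      using that
    proof (induction k arbitrary: v)
      case (Suc k)
      have "s v \<in> e ` U" using sU Suc(2) eU_U by blast
      moreover have "(s ^^ k) (s v) = 0" using Suc(3) by (simp add: funpow_swap1)
      ultimately have "s v = 0" using Suc.IH by blast
      then show ?case using s_inj Suc(2) by blast
    qed simp
    \<comment> \<open>A power of \<open>s\<close> kills \<open>e u - s q(s) e u\<close>, which lies
      in the image of \<open>e\<close>, where \<open>s\<close> is injective. So \<open>e\<close>
      agrees on \<open>U\<close> with the ideal element \<open>s q(s) e\<close>.\<close>
    obtain k p where kp: "\<And>u. u \<in> U \<Longrightarrow> (s ^^ Suc k) (u - s (poly_act s p u)) = 0"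
      using strongly_pi_regular[OF s_lin U(1,2)] algU[OF s_alg] by blast
    let ?q = "poly_act s p"
    have q: "?q \<in> alg R" by (rule alg_poly_act[OF R s_alg])
    have "(s \<circ> (?q \<circ> e)) u = e u" if "u \<in> U" for u
    proof -
      have eu: "e u \<in> U" using algU e that by blast
      have "e u - s (?q (e u)) \<in> e ` U"
        using that sU[OF algU[OF q eu]] by (intro subspace_diff eU) auto
      then have "e u - s (?q (e u)) = 0" using pow_inj kp[OF eu] by blast
      then show ?thesis by simp
    qed
    moreover have "s \<circ> (?q \<circ> e) \<in> ideal_gen R z"
      using e by (intro ideal_mult_right[OF R] alg_comp[OF R q] s_ideal) auto
    ultimately show ?thesis by blast
  qed
  obtain c :: "'v \<Rightarrow> 'a" where c: "\<And>x y. c (x + y) = c x + c y" "\<And>k x. c (scale k x) = k * c x" "c b0 = 1"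
    using exists_functional_1[OF b0(2)] by blast
  \<comment> \<open>On \<open>W\<close> this is the projection onto the kernel of \<open>c\<close>
    along \<open>b0\<close>, an idempotent of rank \<open>dim W - 1\<close>.\<close>
  define E where "E v = v - scale (c v) b0" for v
  have E_lin: "lin E"
    unfolding E_def by (rule linI) (simp_all add: c algebra_simps)
  have EW: "E ` W \<subseteq> W" unfolding E_def using b0 by (auto intro: subspace_diff subspace_scale W(1))
  have E_b0: "E b0 = 0" by (simp add: E_def c)
  have E_idem: "E (E v) = E v" for v
  proof -
    have "E (E v) = E (v - scale (c v) b0)" by (simp only: E_def[of v])
    then show ?thesis using E_b0 by (simp add: lin_diff[OF E_lin] lin_scale[OF E_lin])
  qed
  have "{v \<in> W. E v = 0} = span {b0}"
  proof safe
    fix v assume "E v = 0"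
    then have "v = scale (c v) b0" by (simp add: E_def)
    then show "v \<in> span {b0}" by (metis span_base span_scale singletonI)
  next
    fix v assume "v \<in> span {b0}"
    then obtain k where "v = scale k b0" by (auto simp: span_singleton)
    then show "v \<in> W" "E v = 0" using b0 E_b0 by (auto simp: lin_scale[OF E_lin] intro: subspace_scale W(1))
  qed
  then have dimE: "dim (E ` W) + 1 = dim W"
    using rank_nullity_on[OF E_lin Wf W(1)] dim_span_singleton[OF b0(2)] by simp
  have "e w2 \<noteq> 0" using w2 by simp
  then obtain x where x: "x \<in> ideal_gen R e" "\<And>w. w \<in> W \<Longrightarrow> x w = E w"
    using density[OF R Wf W(1,3,4) _ w2(1) _ E_lin EW] e by blast
  have x_alg: "x \<in> alg R" using ideal_alg[OF R _ x(1)] e by blast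
  have x_lin: "lin x" using alg_lin[OF x_alg R] .
  obtain k p where kp: "\<And>u. u \<in> U \<Longrightarrow> (x ^^ Suc k) (u - x (poly_act x p u)) = 0"
    using strongly_pi_regular[OF x_lin U(1,2)] algU[OF x_alg] by blast
  let ?q = "poly_act x p" and ?X = "x ^^ Suc k"
  have q: "?q \<in> alg R" by (rule alg_poly_act[OF R x_alg])
  define g where "g u = u - x (?q u)" for u
  have g_alg: "g \<in> alg R"
    using alg_minus[OF alg_id alg_comp[OF R x_alg q]] unfolding g_def[abs_def] by simp
  have X_alg: "?X \<in> alg R" by (rule alg_funpow[OF R x_alg])
  have X_lin: "lin ?X" using lin_funpow[OF x_lin] .
  have X_W: "(x ^^ Suc j) w = E w" if "w \<in> W" for j w
  proof (induction j)
    case (Suc j)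
    have "E w \<in> W" using EW that by blast
    then show ?case using Suc x(2) E_idem by simp
  qed (simp add: x(2) that)
  have X_img: "?X ` W = E ` W" using X_W by (intro image_cong) auto
  \<comment> \<open>Otherwise \<open>?X\<close> maps \<open>U\<close> onto the image of
    \<open>W\<close> under \<open>E\<close>, inside \<open>W\<close>. Following it by a rank-one map
    \<open>d\<close> of \<open>W\<close> that fixes some \<open>v1\<close> in that image gives an
    element of rank one on \<open>U\<close>. Such a \<open>v1\<close> exists because
    \<open>2 \<le> dim W\<close>.\<close>
  have "dim W \<le> dim (?X ` U)"
  proof (rule ccontr)
    assume "\<not> ?thesis"
    then have le: "dim (?X ` U) \<le> dim (?X ` W)" using dimE X_img by simp
    have "?X ` W = ?X ` U"
      by (rule subspace_eqI_dim[OF fin_dim_image[OF X_lin U(1)] subspace_image[OF X_lin U(2)]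
            subspace_image[OF X_lin W(1)] image_mono[OF W(2)] le])
    then have XU: "?X ` U = E ` W" using X_img by simp
    have "E ` W \<noteq> {0}"
      using dimE W(5) dim_eq_0_fin_dim[OF fin_dim_image[OF E_lin Wf] subspace_image[OF E_lin W(1)]] by auto
    moreover have "0 \<in> E ` W" using subspace_0[OF subspace_image[OF E_lin W(1)]] .
    ultimately obtain v1 where v1: "v1 \<in> E ` W" "v1 \<noteq> 0" by blast
    have v1W: "v1 \<in> W" "E v1 = v1" using v1 EW E_idem by auto
    obtain c' :: "'v \<Rightarrow> 'a" where c': "\<And>x y. c' (x + y) = c' x + c' y" "\<And>k x. c' (scale k x) = k * c' x" "c' v1 = 1"
      using exists_functional_1[OF v1(2)] by blast
    have D: "lin (\<lambda>v. scale (c' v) v1)" "(\<lambda>v. scale (c' v) v1) ` W \<subseteq> W"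
      using v1W by (auto intro!: linI subspace_scale W(1) simp: c' scale_left_distrib)
    obtain d where d: "d \<in> ideal_gen R id" "\<And>w. w \<in> W \<Longrightarrow> d w = scale (c' w) v1"
      by (rule density[OF R Wf W(1,3,4) alg_id v1W(1) _ D]) (use v1 in auto)
    have d_alg: "d \<in> alg R" using ideal_alg[OF R alg_id d(1)] .
    let ?t = "d \<circ> ?X"
    have t: "?t \<in> alg R" by (rule alg_comp[OF R d_alg X_alg])
    have tv1: "?t v1 = v1" using X_W[OF v1W(1), of k] d(2)[OF v1W(1)] v1W(2) c'(3) by simp
    have "?t ` U \<subseteq> span {v1}"
    proof
      fix y assume "y \<in> ?t ` U"
      then obtain u where "u \<in> U" "y = d (?X u)" by auto
      moreover have "?X u \<in> W" using XU EW \<open>u \<in> U\<close> by blast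
      ultimately show "y \<in> span {v1}" using d(2) by (simp add: span_scale span_base)
    qed
    moreover have "v1 \<in> ?t ` U" using tv1 v1W(1) W(2) by (metis image_eqI subsetD)
    then have "span {v1} \<subseteq> ?t ` U"
      using subspace_image[OF alg_lin[OF t R] U(2)] by (intro span_minimal) auto
    ultimately have "?t ` U = span {v1}" by blast
    then have "dim (?t ` U) = 1" using dim_span_singleton[OF v1(2)] by simp
    then show False using no_rank1[OF t v1W(1)] tv1 v1(2) by simp
  qed
  moreover have "g ` U \<subseteq> {u \<in> U. ?X u = 0}"
    using kp algU[OF g_alg] unfolding g_def by auto
  then have "dim (g ` U) \<le> dim {u \<in> U. ?X u = 0}"
    by (intro dim_subset_fin_dim fin_dim_mono[OF U(1)]) auto
  ultimately have rank: "dim (g ` U) + dim W \<le> dim U"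
    using rank_nullity_on[OF X_lin U(1,2)] by linarith
  have "g b0 = b0"
  proof -
    have "x (?q b0) = ?q (x b0)" by (rule poly_act_commute[OF x_lin, symmetric])
    also have "\<dots> = 0" using x(2)[OF b0(1)] E_b0 lin_0[OF lin_poly_act[OF x_lin]] by simp
    finally show ?thesis by (simp add: g_def)
  qed
  then obtain h1 where h1: "h1 \<in> ideal_gen R g" "\<And>u. u \<in> U \<Longrightarrow> h1 u = e u"
    using e_in[OF g_alg b0(1)] b0(2) by auto
  obtain h2 where h2: "h2 \<in> ideal_gen R g" "\<And>u. u \<in> U \<Longrightarrow> h2 u = x u"
    using ideal_cong_on[OF R U(2,3) x(1) h1] by blast
  have "(\<lambda>u. g u + (h2 \<circ> ?q) u) \<in> ideal_gen R g"
    by (intro ideal_plus ideal_self ideal_mult_right[OF R q] h2)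
  moreover have "g u + (h2 \<circ> ?q) u = u" if "u \<in> U" for u
    using h2(2)[OF algU[OF q that]] by (simp add: g_def)
  ultimately show ?thesis using that g_alg rank by blast
qed

end

section \<open>Small irreducible subfamilies\<close>

context endo_space
begin

lemma irreducible_on_cases:
  "irreducible_on R U \<Longrightarrow> subspace W \<Longrightarrow> W \<subseteq> U \<Longrightarrow> stable R W \<Longrightarrow> W = {0} \<or> W = U"
  unfolding irreducible_on_def by blast

lemma stable_Union: "stable (\<Union>i\<in>I. R i) W \<longleftrightarrow> (\<forall>i\<in>I. stable (R i) W)"
  unfolding stable_def by blast

lemma stableD: "stable R W \<Longrightarrow> f \<in> R \<Longrightarrow> w \<in> W \<Longrightarrow> f w \<in> W"
  unfolding stable_def by blast

lemma stable_Int: "stable R V \<Longrightarrow> stable R W \<Longrightarrow> stable R (V \<inter> W)"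
  unfolding stable_def by blast

text \<open>\<open>M\<close> is a lower bound of the submodule generated by \<open>w\<close> and \<open>K\<close> an upper bound of the largest
  submodule inside the kernel of \<open>\<phi>\<close>; every new index either enlarges \<open>M\<close> or shrinks \<open>K\<close>.\<close>

lemma irreducible_extend:
  fixes \<phi> :: "'v \<Rightarrow> 'a"
  assumes U: "fin_dim U" "subspace U" and R: "\<forall>i\<in>I. \<forall>f\<in>R i. lin f \<and> f ` U \<subseteq> U"
    and irr: "irreducible_on (\<Union>i\<in>I. R i) U"
    and \<phi>: "u0 \<in> U" "\<phi> u0 \<noteq> 0" and w: "w \<noteq> 0"
    and T: "finite T" "T \<subseteq> I"
    and M: "subspace M" "M \<subseteq> U" "w \<in> M" and K: "subspace K" "K \<subseteq> U" "\<forall>y\<in>K. \<phi> y = 0"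
    and genw: "\<And>Y y. subspace Y \<Longrightarrow> Y \<subseteq> U \<Longrightarrow> stable (\<Union>i\<in>T. R i) Y \<Longrightarrow> y \<in> Y \<Longrightarrow> \<phi> y \<noteq> 0 \<Longrightarrow> w \<in> Y"
    and lower: "\<And>Y. subspace Y \<Longrightarrow> Y \<subseteq> U \<Longrightarrow> stable (\<Union>i\<in>T. R i) Y \<Longrightarrow> w \<in> Y \<Longrightarrow> M \<subseteq> Y"
    and upper: "\<And>Y. subspace Y \<Longrightarrow> Y \<subseteq> U \<Longrightarrow> stable (\<Union>i\<in>T. R i) Y \<Longrightarrow> \<forall>y\<in>Y. \<phi> y = 0 \<Longrightarrow> Y \<subseteq> K"
  shows "\<exists>J\<subseteq>I. finite J \<and> card J \<le> card T + (dim U - dim M) + dim K \<and> irreducible_on (\<Union>i\<in>J. R i) U"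
  using T M K genw lower upper
proof (induction "dim U - dim M + dim K" arbitrary: T M K rule: less_induct)
  case less
  note T = less.prems(1,2) and M = less.prems(3-5) and K = less.prems(6-8)
    and genw = less.prems(9) and lower = less.prems(10) and upper = less.prems(11)
  have ins_stable: "stable (\<Union>i\<in>T. R i) Y" "stable (R i) Y" if "stable (\<Union>i\<in>insert i T. R i) Y" for Y i
    using that unfolding stable_Union by auto
  consider "M \<noteq> U" | "K \<noteq> {0}" | "M = U" "K = {0}" by blast
  then show ?case
  proof cases
    case 1
    then have "\<not> stable (\<Union>i\<in>I. R i) M" using irreducible_onD[OF irr M(1,2) _ M(3) w] by blast
    then obtain i f m where f: "i \<in> I" "f \<in> R i" "m \<in> M" "f m \<notin> M" unfolding stable_def by blast
    define M' where "M' = span (insert (f m) M)"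
    have M': "subspace M'" "M \<subset> M'" unfolding M'_def using f(4) span_superset[of "insert (f m) M"] by auto
    have "f m \<in> U" using R f M(2) by blast
    then have M'U: "M' \<subseteq> U" unfolding M'_def using M(2) U(2) by (intro span_minimal) auto
    have dim1: "dim M < dim M'" by (rule dim_psubset_fin_dim[OF fin_dim_mono[OF U(1) M'U] M'(1) M(1) M'(2)])
    have dim2: "dim M' \<le> dim U" by (rule dim_subset_fin_dim[OF U(1) M'U])
    have "\<exists>J\<subseteq>I. finite J \<and> card J \<le> card (insert i T) + (dim U - dim M') + dim K \<and> irreducible_on (\<Union>i\<in>J. R i) U"
    proof (rule less.hyps)
      show "dim U - dim M' + dim K < dim U - dim M + dim K" using dim1 dim2 by linarith
      show "w \<in> M'" using M(3) M'(2) by blast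
      show "M' \<subseteq> Y" if Y: "subspace Y" "Y \<subseteq> U" "stable (\<Union>i\<in>insert i T. R i) Y" "w \<in> Y" for Y
      proof -
        have "M \<subseteq> Y" using lower[OF Y(1,2) ins_stable(1)[OF Y(3)] Y(4)] .
        moreover have "f m \<in> Y" using stableD[OF ins_stable(2)[OF Y(3)] f(2)] f(3) \<open>M \<subseteq> Y\<close> by blast
        ultimately show ?thesis unfolding M'_def using Y(1) by (intro span_minimal) auto
      qed
      show "Y \<subseteq> K" if Y: "subspace Y" "Y \<subseteq> U" "stable (\<Union>i\<in>insert i T. R i) Y" "\<forall>y\<in>Y. \<phi> y = 0" for Y
        using upper[OF Y(1,2) ins_stable(1)[OF Y(3)] Y(4)] .
      show "w \<in> Y" if Y: "subspace Y" "Y \<subseteq> U" "stable (\<Union>i\<in>insert i T. R i) Y" "y \<in> Y" "\<phi> y \<noteq> 0" for Y y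
        using genw[OF Y(1,2) ins_stable(1)[OF Y(3)] Y(4,5)] .
    qed (use T f(1) M' M'U K in auto)
    then obtain J where J: "J \<subseteq> I" "finite J" "irreducible_on (\<Union>i\<in>J. R i) U"
      "card J \<le> card (insert i T) + (dim U - dim M') + dim K" by blast
    have "card (insert i T) \<le> Suc (card T)" using T(1) by (simp add: card_insert_if)
    then have "card J \<le> card T + (dim U - dim M) + dim K" using J(4) dim1 dim2 by linarith
    then show ?thesis using J by blast
  next
    case 2
    then obtain y0 where y0: "y0 \<in> K" "y0 \<noteq> 0" using subspace_0[OF K(1)] by blast
    have "K \<noteq> U" using \<phi> K(3) by blast
    then have "\<not> stable (\<Union>i\<in>I. R i) K" using irreducible_onD[OF irr K(1,2) _ y0] by blast
    then obtain i f k where f: "i \<in> I" "f \<in> R i" "k \<in> K" "f k \<notin> K" unfolding stable_def by blast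
    have f_lin: "lin f" using R f by blast
    define K' where "K' = {y \<in> K. f y \<in> K}"
    have K': "subspace K'" "K' \<subset> K" unfolding K'_def using f(3,4) K(1)
      by (auto simp: subspace_def lin_add[OF f_lin] lin_scale[OF f_lin] lin_0[OF f_lin])
    have dim1: "dim K' < dim K" by (rule dim_psubset_fin_dim[OF fin_dim_mono[OF U(1) K(2)] K(1) K'])
    have "\<exists>J\<subseteq>I. finite J \<and> card J \<le> card (insert i T) + (dim U - dim M) + dim K' \<and> irreducible_on (\<Union>i\<in>J. R i) U"
    proof (rule less.hyps)
      show "dim U - dim M + dim K' < dim U - dim M + dim K" using dim1 by linarith
      show "M \<subseteq> Y" if Y: "subspace Y" "Y \<subseteq> U" "stable (\<Union>i\<in>insert i T. R i) Y" "w \<in> Y" for Y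
        using lower[OF Y(1,2) ins_stable(1)[OF Y(3)] Y(4)] .
      show "Y \<subseteq> K'" if Y: "subspace Y" "Y \<subseteq> U" "stable (\<Union>i\<in>insert i T. R i) Y" "\<forall>y\<in>Y. \<phi> y = 0" for Y
      proof -
        have "Y \<subseteq> K" using upper[OF Y(1,2) ins_stable(1)[OF Y(3)] Y(4)] .
        then show ?thesis unfolding K'_def using stableD[OF ins_stable(2)[OF Y(3)] f(2)] by blast
      qed
      show "w \<in> Y" if Y: "subspace Y" "Y \<subseteq> U" "stable (\<Union>i\<in>insert i T. R i) Y" "y \<in> Y" "\<phi> y \<noteq> 0" for Y y
        using genw[OF Y(1,2) ins_stable(1)[OF Y(3)] Y(4,5)] .
    qed (use T f(1) M K K' in auto)
    then obtain J where J: "J \<subseteq> I" "finite J" "irreducible_on (\<Union>i\<in>J. R i) U"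
      "card J \<le> card (insert i T) + (dim U - dim M) + dim K'" by blast
    have "card (insert i T) \<le> Suc (card T)" using T(1) by (simp add: card_insert_if)
    then have "card J \<le> card T + (dim U - dim M) + dim K" using J(4) dim1 by linarith
    then show ?thesis using J by blast
  next
    case 3
    \<comment> \<open>With no room left, a stable \<open>Y\<close> inside the kernel of
      \<open>\<phi>\<close> is zero; any other contains \<open>w\<close> by \<open>genw\<close>,
      hence \<open>M = U\<close>.\<close>
    have "irreducible_on (\<Union>i\<in>T. R i) U"
      unfolding irreducible_on_def
    proof (intro allI impI)
      fix Y assume "subspace Y \<and> Y \<subseteq> U \<and> stable (\<Union>i\<in>T. R i) Y"
      then have Y: "subspace Y" "Y \<subseteq> U" "stable (\<Union>i\<in>T. R i) Y" by auto
      show "Y = {0} \<or> Y = U"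
      proof (cases "\<forall>y\<in>Y. \<phi> y = 0")
        case True
        then show ?thesis using upper[OF Y True] 3 subspace_0[OF Y(1)] by blast
      next
        case False
        then obtain y where "y \<in> Y" "\<phi> y \<noteq> 0" by blast
        then have "w \<in> Y" using genw[OF Y] by blast
        then show ?thesis using lower[OF Y] 3 Y(2) by blast
      qed
    qed
    then show ?thesis using T by (intro exI[of _ T]) auto
  qed
qed

text \<open>The ideal of \<open>g\<close> contains an element acting as the identity on
  \<open>U\<close>, so stable subspaces of \<open>U\<close> can be tested on the image of
  \<open>g\<close>, with each map \<open>s\<close> replaced by its compressions
  \<open>g b s b'\<close>. The index of \<open>s\<close> is kept, so that a choice of indices for
  the image yields one for \<open>U\<close>; \<open>J1\<close> is added because \<open>g\<close>,
  \<open>b\<close> and \<open>b'\<close> come from it.\<close>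

lemma corner:
  fixes R :: "'i \<Rightarrow> ('v \<Rightarrow> 'v) set"
  assumes U: "subspace U" and R: "\<forall>i\<in>I. \<forall>f\<in>R i. lin f \<and> f ` U \<subseteq> U"
    and irr: "irreducible_on (\<Union>i\<in>I. R i) U" and J1: "J1 \<subseteq> I" and I: "I \<noteq> {}"
    and g: "g \<in> alg (\<Union>i\<in>J1. R i)"
    and h1: "h \<in> ideal_gen (\<Union>i\<in>J1. R i) g" and h2: "\<forall>u\<in>U. h u = u"
  defines "S \<equiv> \<lambda>i. {g \<circ> b \<circ> s \<circ> b' |b s b'. b \<in> alg (\<Union>i\<in>J1. R i) \<and> s \<in> insert id (R i) \<and> b' \<in> alg (\<Union>i\<in>J1. R i)}"
  shows corner_maps: "\<forall>i\<in>I. \<forall>f\<in>S i. lin f \<and> f ` g ` U \<subseteq> g ` U"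
    and corner_irreducible: "irreducible_on (\<Union>i\<in>I. S i) (g ` U)"
    and corner_lift: "J' \<subseteq> I \<Longrightarrow> irreducible_on (\<Union>i\<in>J'. S i) (g ` U) \<Longrightarrow> irreducible_on (\<Union>i\<in>J1 \<union> J'. R i) U"
proof -
  let ?R1 = "\<Union>i\<in>J1. R i"
  note h = h1 h2[rule_format]
  have R1: "\<forall>f\<in>?R1. lin f" using R J1 by blast
  have st: "stable ?R1 U" unfolding stable_def using R J1 by blast
  have algU: "a u \<in> U" if "a \<in> alg ?R1" "u \<in> U" for a u using alg_stable[OF that(1) st U that(2)] .
  have g_lin: "lin g" using alg_lin[OF g R1] .
  have s_lin: "lin s" and s_U: "u \<in> U \<Longrightarrow> s u \<in> U" if "i \<in> I" "s \<in> insert id (R i)" for i s u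
    using R that lin_id by auto
  have S_I: "(g \<circ> b \<circ> s \<circ> b') \<in> S i" if "b \<in> alg ?R1" "s \<in> insert id (R i)" "b' \<in> alg ?R1" for b s b' i
    unfolding S_def using that by blast
  show "\<forall>i\<in>I. \<forall>f\<in>S i. lin f \<and> f ` g ` U \<subseteq> g ` U"
  proof (intro ballI)
    fix i f assume i: "i \<in> I" and "f \<in> S i"
    then obtain b s b' where f: "f = g \<circ> b \<circ> s \<circ> b'" "b \<in> alg ?R1" "s \<in> insert id (R i)" "b' \<in> alg ?R1"
      unfolding S_def by blast
    have "lin f" unfolding f(1) by (intro lin_comp g_lin alg_lin[OF f(2) R1] alg_lin[OF f(4) R1] s_lin[OF i f(3)])
    moreover have "f (g u) \<in> g ` U" if "u \<in> U" for u
    proof -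
      have "b (s (b' (g u))) \<in> U" using algU[OF f(2)] s_U[OF i f(3)] algU[OF f(4)] algU[OF g that] by blast
      then show ?thesis unfolding f(1) by simp
    qed
    ultimately show "lin f \<and> f ` g ` U \<subseteq> g ` U" by blast
  qed
  show "irreducible_on (\<Union>i\<in>I. S i) (g ` U)"
    unfolding irreducible_on_def
  proof (intro allI impI)
    fix Y assume "subspace Y \<and> Y \<subseteq> g ` U \<and> stable (\<Union>i\<in>I. S i) Y"
    then have Y: "subspace Y" "Y \<subseteq> g ` U" "stable (\<Union>i\<in>I. S i) Y" by auto
    have YU: "Y \<subseteq> U" using Y(2) algU[OF g] by blast
    show "Y = {0} \<or> Y = g ` U"
    proof (cases "Y = {0}")
      case False
      then obtain y0 where y0: "y0 \<in> Y" "y0 \<noteq> 0" using subspace_0[OF Y(1)] by blast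
      \<comment> \<open>\<open>V\<close> is the submodule of \<open>U\<close> that \<open>Y\<close>
        should come from: \<open>key\<close> shows that it is stable, and then \<open>V = U\<close>
        forces the image of \<open>g\<close> into \<open>Y\<close>.\<close>
      define V where "V = {u \<in> U. \<forall>b\<in>alg ?R1. g (b u) \<in> Y}"
      have gb_lin: "lin (g \<circ> b)" if "b \<in> alg ?R1" for b by (intro lin_comp g_lin alg_lin[OF that R1])
      have "subspace V"
        using U Y(1) lin_add[OF gb_lin] lin_scale[OF gb_lin] lin_0[OF gb_lin]
        unfolding V_def subspace_def comp_def by auto
      moreover have "V \<subseteq> U" unfolding V_def by blast
      moreover have "stable (\<Union>i\<in>I. R i) V"
        unfolding stable_Union
      proof
        fix i assume i: "i \<in> I"
        show "stable (R i) V"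
          unfolding stable_def
        proof safe
          fix s u assume s: "s \<in> R i" and u: "u \<in> V"
          have uU: "u \<in> U" using u unfolding V_def by blast
          \<comment> \<open>The identity is inserted before \<open>s\<close> as \<open>h\<close>, a
            combination of maps \<open>a g b'\<close>: the vector \<open>g b' u\<close> is in
            \<open>Y\<close>, and \<open>g b s a\<close> is a compression, which preserves
            \<open>Y\<close>.\<close>
          have key: "g (b (s (k u))) \<in> Y" if "b \<in> alg ?R1" "k \<in> ideal_gen ?R1 g" for b k
            using that(2)
          proof induction
            case (ideal_base a b')
            have "g (b' u) \<in> Y" using u ideal_base(2) unfolding V_def by blast
            moreover have "g \<circ> b \<circ> s \<circ> a \<in> S i" using s that(1) ideal_base(1) by (intro S_I) auto
            ultimately have "(g \<circ> b \<circ> s \<circ> a) (g (b' u)) \<in> Y" using Y(3) i stableD unfolding stable_Union by blast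
            then show ?case by simp
          next
            case (ideal_plus k k')
            have l: "lin (g \<circ> b \<circ> s)" using s i by (intro lin_comp gb_lin that s_lin) auto
            have "(g \<circ> b \<circ> s) (k u + k' u) \<in> Y"
              unfolding lin_add[OF l] using ideal_plus by (intro subspace_add Y(1)) auto
            then show ?case by simp
          next
            case (ideal_scale k c)
            have l: "lin (g \<circ> b \<circ> s)" using s i by (intro lin_comp gb_lin that s_lin) auto
            have "(g \<circ> b \<circ> s) (scale c (k u)) \<in> Y"
              unfolding lin_scale[OF l] using ideal_scale by (intro subspace_scale Y(1)) auto
            then show ?case by simp
          qed
          have "g (b (s u)) \<in> Y" if "b \<in> alg ?R1" for b using key[OF that h(1)] h(2)[OF uU] by simp
          moreover have "s u \<in> U" using s_U[OF i] s uU by blast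
          ultimately show "s u \<in> V" unfolding V_def by blast
        qed
      qed
      moreover have "Y \<subseteq> V"
      proof
        fix y assume y: "y \<in> Y"
        obtain i where i: "i \<in> I" using I by blast
        have "g (b y) \<in> Y" if "b \<in> alg ?R1" for b
        proof -
          \<comment> \<open>Having \<open>id\<close> among the admissible \<open>s\<close> makes
            \<open>g b\<close> itself a compression; it is attached to an arbitrary index, which
            exists by \<open>I \<noteq> {}\<close>.\<close>
          have "g \<circ> b \<circ> id \<circ> id \<in> S i" using that by (intro S_I alg_id) auto
          then show ?thesis using stableD[of "S i" Y _ y] Y(3) i y unfolding stable_Union by force
        qed
        then show "y \<in> V" using y YU unfolding V_def by blast
      qed
      ultimately have "V = U" using irreducible_onD[OF irr] y0 by blast
      then have "g u \<in> Y" if "u \<in> U" for u using that alg_id[of ?R1] unfolding V_def by fastforce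
      then show ?thesis using Y(2) by blast
    qed simp
  qed
  assume J': "J' \<subseteq> I" and irr': "irreducible_on (\<Union>i\<in>J'. S i) (g ` U)"
  show "irreducible_on (\<Union>i\<in>J1 \<union> J'. R i) U"
    unfolding irreducible_on_def
  proof (intro allI impI)
    fix Y assume "subspace Y \<and> Y \<subseteq> U \<and> stable (\<Union>i\<in>J1 \<union> J'. R i) Y"
    then have Y: "subspace Y" "Y \<subseteq> U" "stable ?R1 Y" "stable (\<Union>i\<in>J'. R i) Y"
      unfolding stable_Union by auto
    have algY: "a y \<in> Y" if "a \<in> alg ?R1" "y \<in> Y" for a y using alg_stable[OF that(1) Y(3,1) that(2)] .
    have "stable (\<Union>i\<in>J'. S i) (g ` Y)"
      unfolding stable_Union stable_def
    proof safe
      fix i f y assume i: "i \<in> J'" and "f \<in> S i" and y: "y \<in> Y"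
      then obtain b s b' where f: "f = g \<circ> b \<circ> s \<circ> b'" "b \<in> alg ?R1" "s \<in> insert id (R i)" "b' \<in> alg ?R1"
        unfolding S_def by blast
      have "b' (g y) \<in> Y" using algY f(4) g y by blast
      then have "s (b' (g y)) \<in> Y" using f(3) i Y(4) stableD unfolding stable_Union by (metis id_apply insertE)
      then have "b (s (b' (g y))) \<in> Y" using algY f(2) by blast
      then show "f (g y) \<in> g ` Y" unfolding f(1) by simp
    qed
    then have "g ` Y = {0} \<or> g ` Y = g ` U"
      by (rule irreducible_on_cases[OF irr' subspace_image[OF g_lin Y(1)] image_mono[OF Y(2)]])
    then consider "g ` Y = {0}" | "g ` Y = g ` U" by (elim disjE)
    then show "Y = {0} \<or> Y = U"
    proof cases
      case 1
      have "y = 0" if "y \<in> Y" for y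
      proof -
        have "h y \<in> {0}"
          by (rule ideal_maps[OF R1 h(1) Y(1,3) _ _ _ that])
            (use 1 R1 in \<open>auto simp: stable_def lin_0\<close>)
        then show ?thesis using h(2) that Y(2) by auto
      qed
      then show ?thesis using subspace_0[OF Y(1)] by blast
    next
      case 2
      have "g ` U \<subseteq> Y" unfolding 2[symmetric] using algY[OF g] by blast
      then have "h u \<in> Y" if "u \<in> U" for u by (rule ideal_maps[OF R1 h(1) U st Y(1,3) _ that])
      then show ?thesis using h(2) Y(2) by auto
    qed
  qed
qed

text \<open>The \<open>w i\<close> contain a circuit \<open>C\<close> with at most \<open>dim U + 1\<close> members. Its span is stable, hence
  all of \<open>U\<close>, so that an index outside \<open>C\<close> acts by scalars and is redundant.\<close>

lemma card_le_if_common_eigenvectors: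
  fixes w :: "'i \<Rightarrow> 'v"
  assumes U: "fin_dim U" "subspace U" "2 \<le> dim U" and I: "finite I"
    and R: "\<forall>i\<in>I. \<forall>f\<in>R i. lin f"
    and irr: "irreducible_on (\<Union>i\<in>I. R i) U"
    and min: "\<And>i. i \<in> I \<Longrightarrow> \<not> irreducible_on (\<Union>i\<in>I - {i}. R i) U"
    and w: "\<And>i. i \<in> I \<Longrightarrow> w i \<in> U" "\<And>i. i \<in> I \<Longrightarrow> w i \<noteq> 0"
      "\<And>i j f. i \<in> I \<Longrightarrow> j \<in> I \<Longrightarrow> i \<noteq> j \<Longrightarrow> f \<in> R j \<Longrightarrow> \<exists>l. f (w i) = scale l (w i)"
  shows "card I \<le> dim U + 1"
proof (rule ccontr)
  assume "\<not> ?thesis"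
  then have large: "dim U + 1 < card I" by simp
  \<comment> \<open>Every index differs from \<open>i\<close> or from \<open>j\<close>, so a
    repeated vector would be a common eigenvector of the whole family, and its line would be all of
    \<open>U\<close>.\<close>
  have inj: "inj_on w I"
  proof (rule inj_onI, rule ccontr)
    fix i j assume ij: "i \<in> I" "j \<in> I" "w i = w j" "i \<noteq> j"
    have "stable (\<Union>i\<in>I. R i) (span {w i})"
      unfolding stable_Union stable_def
    proof safe
      fix k f v assume k: "k \<in> I" "f \<in> R k" "v \<in> span {w i}"
      obtain l where l: "f (w i) = scale l (w i)" using w(3)[of i k f] w(3)[of j k f] ij k by metis
      obtain c where "v = scale c (w i)" using k(3) by (auto simp: span_singleton)
      moreover have "lin f" using R k by blast
      ultimately show "f v \<in> span {w i}" using l by (simp add: lin_scale span_scale span_base)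
    qed
    then have "span {w i} = U"
      using irreducible_onD[OF irr, of "span {w i}" "w i"] w(1,2)[OF ij(1)] span_minimal[of "{w i}" U] U(2)
      by (auto simp: span_base)
    then show False using dim_span_singleton[OF w(2)[OF ij(1)]] U(3) by simp
  qed
  define dep where "dep C \<longleftrightarrow> (\<exists>u. (\<Sum>c\<in>C. scale (u c) (w c)) = 0 \<and> (\<exists>c\<in>C. u c \<noteq> 0))" for C
  obtain I0 where I0: "I0 \<subseteq> I" "card I0 = dim U + 1" "finite I0"
    using large obtain_subset_with_card_n by (metis less_imp_le)
  have inj0: "inj_on w I0" using inj inj_on_subset I0(1) by blast
  have "dependent (w ` I0)"
  proof (rule ccontr)
    assume "indep (w ` I0)"
    then have "dim (w ` I0) = card I0" by (simp add: dim_eq_card_independent card_image[OF inj0])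
    moreover have "dim (w ` I0) \<le> dim U" using w(1) I0(1) by (intro dim_subset_fin_dim U(1)) auto
    ultimately show False using I0(2) by simp
  qed
  then obtain u where "(\<Sum>v\<in>w ` I0. scale (u v) v) = 0" "\<exists>v\<in>w ` I0. u v \<noteq> 0"
    using dependent_finite[of "w ` I0"] I0(3) by blast
  then have "dep I0" unfolding dep_def using inj0 by (intro exI[of _ "u \<circ> w"]) (auto simp: sum.reindex)
  let ?P = "\<lambda>C. C \<subseteq> I \<and> dep C"
  have "?P I0" using \<open>dep I0\<close> I0(1) by blast
  then obtain C where C: "C \<subseteq> I" "dep C" and Cmin: "\<And>D. ?P D \<Longrightarrow> card C \<le> card D"
    using ex_has_least_nat[of ?P I0 card] by blast
  have finC: "finite C" using C(1) I finite_subset by blast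
  have "card C \<le> dim U + 1" using Cmin[OF \<open>?P I0\<close>] I0(2) by simp
  then have "C \<noteq> I" using large by auto
  then obtain j where j: "j \<in> I" "j \<notin> C" using C(1) by blast
  have nodep: "v d = 0"
    if "c \<in> C" "(\<Sum>d\<in>C - {c}. scale (v d) (w d)) = 0" "d \<in> C - {c}" for v c d
  proof (rule ccontr)
    assume "v d \<noteq> 0"
    then have "?P (C - {c})" using that C(1) unfolding dep_def by blast
    then have "card C \<le> card (C - {c})" by (rule Cmin)
    then show False using card_Diff1_less[OF finC that(1)] by linarith
  qed
  obtain u where u: "(\<Sum>c\<in>C. scale (u c) (w c)) = 0" "\<exists>c\<in>C. u c \<noteq> 0" using C(2) unfolding dep_def by blast
  have u_nz: "u c \<noteq> 0" if "c \<in> C" for c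
  proof
    assume "u c = 0"
    then have "(\<Sum>d\<in>C - {c}. scale (u d) (w d)) = 0" using u(1) that finC by (simp add: sum.remove)
    then have "u d = 0" if "d \<in> C - {c}" for d using nodep[OF \<open>c \<in> C\<close>] that by blast
    then show False using u(2) \<open>u c = 0\<close> by auto
  qed
  let ?Y = "span (w ` C)"
  have YU: "?Y \<subseteq> U" using w(1) C(1) U(2) by (intro span_minimal) auto
  have "stable (\<Union>i\<in>I. R i) ?Y"
    unfolding stable_Union stable_def
  proof safe
    fix i f v assume i: "i \<in> I" "f \<in> R i" and v: "v \<in> ?Y"
    have f_lin: "lin f" using R i by blast
    have other: "f (w c) \<in> ?Y" if c: "c \<in> C" "c \<noteq> i" for c
    proof -
      obtain l where "f (w c) = scale l (w c)" using w(3)[of c i f] c i C(1) by blast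
      then show ?thesis using c by (simp add: span_scale span_base)
    qed
    \<comment> \<open>Only maps of index \<open>i\<close> may fail to have \<open>w i\<close> as an
      eigenvector. There the circuit relation expresses \<open>f (w i)\<close> through the other
      images, as the coefficient \<open>u i\<close> is nonzero.\<close>
    have self: "f (w i) \<in> ?Y" if "i \<in> C"
    proof -
      have "0 = f (\<Sum>c\<in>C. scale (u c) (w c))" using u(1) lin_0[OF f_lin] by simp
      also have "\<dots> = scale (u i) (f (w i)) + (\<Sum>c\<in>C - {i}. scale (u c) (f (w c)))"
        unfolding lin_sum[OF f_lin] lin_scale[OF f_lin] by (rule sum.remove[OF finC that])
      finally have "scale (u i) (f (w i)) = - (\<Sum>c\<in>C - {i}. scale (u c) (f (w c)))"
        by (simp add: eq_neg_iff_add_eq_0)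
      moreover have "(\<Sum>c\<in>C - {i}. scale (u c) (f (w c))) \<in> ?Y"
        using other by (intro span_sum span_scale) auto
      ultimately have "scale (1 / u i) (scale (u i) (f (w i))) \<in> ?Y" by (simp add: span_neg span_scale)
      then show ?thesis using u_nz[OF that] by simp
    qed
    have fC: "f x \<in> ?Y" if "x \<in> w ` C" for x using that other self by blast
    show "f v \<in> ?Y" using v
      by (induction rule: span_induct_alt)
        (auto simp: lin_0[OF f_lin] lin_add[OF f_lin] lin_scale[OF f_lin] span_zero
          intro!: span_add span_scale fC)
  qed
  moreover obtain c0 where c0: "c0 \<in> C" using u(2) by blast
  ultimately have Y: "?Y = U"
    using irreducible_onD[OF irr subspace_span YU, of "w c0"] w(2) C(1) by (auto simp: span_base)
  \<comment> \<open>As \<open>j\<close> is outside the circuit, \<open>f\<close> multiplies each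
    \<open>w c\<close> by some \<open>l c\<close>. Subtracting \<open>l c0\<close> times the
    relation from its image under \<open>f\<close> gives a relation without \<open>c0\<close>, so
    all \<open>l c\<close> agree.\<close>
  have scalar: "\<exists>l. \<forall>v\<in>U. f v = scale l v" if f: "f \<in> R j" for f
  proof -
    have f_lin: "lin f" using R f j by blast
    have "\<exists>l. f (w c) = scale l (w c)" if "c \<in> C" for c using w(3)[of c j f] that C(1) j f by blast
    then obtain l where l: "\<And>c. c \<in> C \<Longrightarrow> f (w c) = scale (l c) (w c)" by metis
    have "0 = f (\<Sum>c\<in>C. scale (u c) (w c)) - scale (l c0) (\<Sum>c\<in>C. scale (u c) (w c))"
      using u(1) lin_0[OF f_lin] by simp
    also have "\<dots> = (\<Sum>c\<in>C. scale (u c * (l c - l c0)) (w c))"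
      by (simp add: lin_sum[OF f_lin] lin_scale[OF f_lin] l scale_sum_right algebra_simps
          scale_left_diff_distrib sum_subtractf cong: sum.cong)
    also have "\<dots> = (\<Sum>c\<in>C - {c0}. scale (u c * (l c - l c0)) (w c))"
      using c0 finC by (simp add: sum.remove[of _ c0])
    finally have sum0: "(\<Sum>c\<in>C - {c0}. scale (u c * (l c - l c0)) (w c)) = 0" by simp
    have eq: "l c = l c0" if "c \<in> C" for c
      using nodep[OF c0 sum0, of c] u_nz[OF that] that by (cases "c = c0") auto
    have "f v = scale (l c0) v" if "v \<in> U" for v
      using that unfolding Y[symmetric]
      by (induction rule: span_induct_alt)
        (auto simp: lin_0[OF f_lin] lin_add[OF f_lin] lin_scale[OF f_lin] l eq scale_right_distrib mult.commute)
    then show ?thesis by blast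
  qed
  have "irreducible_on (\<Union>i\<in>I - {j}. R i) U"
    unfolding irreducible_on_def
  proof (intro allI impI)
    fix V assume "subspace V \<and> V \<subseteq> U \<and> stable (\<Union>i\<in>I - {j}. R i) V"
    then have V: "subspace V" "V \<subseteq> U" "stable (\<Union>i\<in>I - {j}. R i) V" by auto
    have "stable (R j) V"
      unfolding stable_def
    proof safe
      fix f v assume "f \<in> R j" "v \<in> V"
      then obtain l where "f v = scale l v" using scalar V(2) by blast
      then show "f v \<in> V" using \<open>v \<in> V\<close> V(1) by (simp add: subspace_scale)
    qed
    then have "stable (\<Union>i\<in>I. R i) V" using V(3) unfolding stable_Union by blast
    then show "V = {0} \<or> V = U" by (rule irreducible_on_cases[OF irr V(1,2)])
  qed
  then show False using min[OF j(1)] by blast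
qed

end

context alg_closed_space
begin

text \<open>Each index carries a set of maps and not a single one, because the induction is applied
  to the compressions in \<open>corner\<close>, which attach many maps to one index.\<close>

theorem irreducible_subfamily:
  fixes R :: "'i \<Rightarrow> ('v \<Rightarrow> 'v) set"
  assumes "fin_dim U" "subspace U" "1 \<le> dim U" "finite I"
    and "\<forall>i\<in>I. \<forall>f\<in>R i. lin f \<and> f ` U \<subseteq> U"
    and "irreducible_on (\<Union>i\<in>I. R i) U"
  shows "\<exists>J\<subseteq>I. card J \<le> 2 * dim U - 1 \<and> irreducible_on (\<Union>i\<in>J. R i) U"
  using assms
proof (induction "dim U" arbitrary: U I R rule: less_induct)
  case less
  note U = less.prems(1-3)
  have "\<exists>I'. I' \<subseteq> I \<and> irreducible_on (\<Union>i\<in>I'. R i) U" using less.prems(6) by blast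
  then obtain I' where I': "I' \<subseteq> I" "irreducible_on (\<Union>i\<in>I'. R i) U"
    and min: "\<And>D. D \<subseteq> I \<and> irreducible_on (\<Union>i\<in>D. R i) U \<Longrightarrow> card I' \<le> card D"
    using ex_has_least_nat[of "\<lambda>D. D \<subseteq> I \<and> irreducible_on (\<Union>i\<in>D. R i) U" _ card] by blast
  have fin: "finite I'" using I'(1) less.prems(4) finite_subset by blast
  have R: "\<forall>i\<in>I'. \<forall>f\<in>R i. lin f \<and> f ` U \<subseteq> U" using I'(1) less.prems(5) by blast
  have crit: "\<not> irreducible_on (\<Union>i\<in>I' - {i}. R i) U" if "i \<in> I'" for i
  proof
    assume "irreducible_on (\<Union>i\<in>I' - {i}. R i) U"
    then have "card I' \<le> card (I' - {i})" using I'(1) by (intro min) auto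
    then show False using card_Diff1_less[OF fin that] by linarith
  qed
  have "\<exists>J\<subseteq>I'. card J \<le> 2 * dim U - 1 \<and> irreducible_on (\<Union>i\<in>J. R i) U"
  proof (cases "dim U = 1")
    case True
    have "V = {0} \<or> V = U" if "subspace V" "V \<subseteq> U" for V
    proof (cases "dim V = 0")
      case True
      then show ?thesis using dim_eq_0_fin_dim[OF fin_dim_mono[OF U(1) that(2)] that(1)] by simp
    next
      case False
      then show ?thesis using subspace_eqI_dim[OF U(1,2) that] \<open>dim U = 1\<close> by simp
    qed
    \<comment> \<open>In dimension one there is no proper nonzero subspace at all, so the empty
      subfamily suffices.\<close>
    then have "irreducible_on (\<Union>i\<in>{}. R i) U" unfolding irreducible_on_def by blast
    then show ?thesis by (intro exI[of _ "{}"]) auto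
  next
    case False
    then have dimU: "2 \<le> dim U" using U(3) by simp
    define ev where "ev a w \<longleftrightarrow> w \<in> U \<and> w \<noteq> 0 \<and> (\<forall>j\<in>I'. j \<noteq> a \<longrightarrow> (\<forall>f\<in>R j. \<exists>l. f w = scale l w))" for a w
    show ?thesis
    proof (cases "\<forall>a\<in>I'. \<exists>w. ev a w")
      case True
      then obtain w where w: "\<And>a. a \<in> I' \<Longrightarrow> ev a (w a)" by metis
      have "card I' \<le> dim U + 1"
        by (rule card_le_if_common_eigenvectors[OF U(1,2) dimU fin _ I'(2) crit, of w])
          (use R w in \<open>auto simp: ev_def\<close>)
      then show ?thesis using I'(2) dimU by (intro exI[of _ I']) auto
    next
      case False
      then obtain a where a: "a \<in> I'" and no_ev: "\<And>w. \<not> ev a w" by blast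
      let ?R' = "\<Union>i\<in>I' - {a}. R i"
      \<comment> \<open>A stable subspace of least dimension is taken for the family without
        \<open>a\<close>. It is proper because \<open>a\<close> is indispensable by
        \<open>crit\<close>, and it is not a line because a spanning vector would satisfy
        \<open>ev a\<close>.\<close>
      let ?P = "\<lambda>W. subspace W \<and> W \<subseteq> U \<and> W \<noteq> {0} \<and> stable ?R' W"
      have "U \<noteq> {0}" using dim_eq_0_fin_dim[OF U(1,2)] dimU by auto
      then have "?P U" using U(2) R unfolding stable_def by blast
      then obtain W where W: "subspace W" "W \<subseteq> U" "W \<noteq> {0}" "stable ?R' W"
        and Wmin: "\<And>V. ?P V \<Longrightarrow> dim W \<le> dim V"
        using ex_has_least_nat[of ?P U dim] by blast
      have Wf: "fin_dim W" using fin_dim_mono[OF U(1) W(2)] .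
      have irrW: "irreducible_on ?R' W"
        unfolding irreducible_on_def
      proof (intro allI impI)
        fix V assume V: "subspace V \<and> V \<subseteq> W \<and> stable ?R' V"
        show "V = {0} \<or> V = W"
        proof (cases "V = {0}")
          case False
          then have "dim W \<le> dim V" using V W(2) by (intro Wmin) auto
          then show ?thesis using subspace_eqI_dim[OF Wf W(1)] V by blast
        qed simp
      qed
      have "W \<noteq> U" using irrW crit[OF a] by blast
      then have dimWU: "dim W < dim U" using dim_psubset_fin_dim[OF U(1,2) W(1)] W(2) by blast
      have "dim W \<noteq> 0" using dim_eq_0_fin_dim[OF Wf W(1)] W(3) by simp
      moreover have "dim W \<noteq> 1"
      proof
        assume "dim W = 1"
        then obtain v where v: "v \<noteq> 0" "W = span {v}" by (rule exists_dim_1_span[OF Wf W(1)])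
        have "ev a v"
          unfolding ev_def
        proof (intro conjI ballI impI)
          show "v \<in> U" using v W(2) span_base by blast
          fix j f assume "j \<in> I'" "j \<noteq> a" "f \<in> R j"
          then have "f v \<in> span {v}" using stableD[OF W(4), of f v] v(2) by (auto simp: span_base)
          then show "\<exists>l. f v = scale l v" by (auto simp: span_singleton)
        qed (rule v(1))
        then show False using no_ev by blast
      qed
      ultimately have dimW: "2 \<le> dim W" by simp
      have "\<forall>i\<in>I' - {a}. \<forall>f\<in>R i. lin f \<and> f ` W \<subseteq> W" using R W(4) unfolding stable_def by blast
      then obtain J1 where J1: "J1 \<subseteq> I' - {a}" "card J1 \<le> 2 * dim W - 1" "irreducible_on (\<Union>i\<in>J1. R i) W"
        using less.hyps[OF dimWU Wf W(1) _ _ _ irrW] dimW fin by auto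
      let ?R1 = "\<Union>i\<in>J1. R i"
      have J1I: "J1 \<subseteq> I'" and finJ1: "finite J1" using J1(1) fin finite_subset by blast+
      have R1: "\<forall>f\<in>?R1. lin f" using R J1I by blast
      have stU: "stable ?R1 U" using R J1I unfolding stable_def by blast
      have stW: "stable ?R1 W" using W(4) J1(1) unfolding stable_def by blast
      have algU: "b u \<in> U" if "b \<in> alg ?R1" "u \<in> U" for b u using alg_stable[OF that(1) stU U(2) that(2)] .
      show ?thesis
      proof (cases "\<exists>t\<in>alg ?R1. \<exists>w\<in>W. t w \<noteq> 0 \<and> dim (t ` U) = 1")
        case True
        then obtain t w0 where t: "t \<in> alg ?R1" "w0 \<in> W" "t w0 \<noteq> 0" "dim (t ` U) = 1" by blast
        have t_lin: "lin t" using alg_lin[OF t(1) R1] .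
        define w where "w = t w0"
        have wW: "w \<in> W" unfolding w_def using alg_stable[OF t(1) stW W(1) t(2)] .
        have "w0 \<in> U" using t(2) W(2) by blast
        then have "w \<in> t ` U" unfolding w_def by blast
        have tU: "subspace (t ` U)" "fin_dim (t ` U)"
          using subspace_image[OF t_lin U(2)] fin_dim_image[OF t_lin U(1)] by auto
        have w_nz: "w \<noteq> 0" using t(3) unfolding w_def .
        have "span {w} = t ` U"
          using \<open>w \<in> t ` U\<close> tU(1) dim_span_singleton[OF w_nz] t(4)
          by (intro subspace_eqI_dim tU span_minimal) auto
        obtain c :: "'v \<Rightarrow> 'a" where c: "\<And>x y. c (x + y) = c x + c y" "\<And>k x. c (scale k x) = k * c x" "c w = 1"
          using exists_functional_1[OF w_nz] by blast
        define \<phi> where "\<phi> u = c (t u)" for u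
        have c0: "c 0 = 0" using c(2)[of 0 0] by simp
        have t_eq: "t u = scale (\<phi> u) w" if "u \<in> U" for u
        proof -
          have "t u \<in> span {w}" using that \<open>span {w} = t ` U\<close> by blast
          then show ?thesis using c(2,3) unfolding \<phi>_def by (auto simp: span_singleton)
        qed
        \<comment> \<open>The largest submodule inside the kernel of \<open>\<phi>\<close>. It meets
          the irreducible \<open>W\<close> only in zero because \<open>\<phi> w0 = 1\<close>, which
          bounds its dimension by \<open>dim U - dim W\<close>.\<close>
        define K where "K = {u \<in> U. \<forall>b\<in>alg ?R1. \<phi> (b u) = 0}"
        have K: "subspace K" "K \<subseteq> U"
          using U(2) alg_lin[OF _ R1]
          unfolding K_def subspace_def \<phi>_def
          by (auto simp: lin_add lin_scale lin_0 lin_add[OF t_lin] lin_scale[OF t_lin] lin_0[OF t_lin] c c0)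
        have K\<phi>: "\<forall>y\<in>K. \<phi> y = 0" unfolding K_def using alg_id[of ?R1] by force
        have "stable ?R1 K"
          unfolding stable_def
        proof (intro ballI image_subsetI)
          fix f k assume f: "f \<in> ?R1" and k: "k \<in> K"
          have "\<phi> (b (f k)) = 0" if "b \<in> alg ?R1" for b
            using k alg_comp[OF R1 that alg_base[OF f]] unfolding K_def by force
          moreover have "f k \<in> U" using stableD[OF stU f] k unfolding K_def by blast
          ultimately show "f k \<in> K" unfolding K_def by blast
        qed
        then have "stable ?R1 (K \<inter> W)" using stW stable_Int by blast
        then have "K \<inter> W = {0} \<or> K \<inter> W = W"
          by (rule irreducible_on_cases[OF J1(3) subspace_inter[OF K(1) W(1)] Int_lower2])
        moreover have "w0 \<notin> K" using K\<phi> c(3) unfolding \<phi>_def w_def by auto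
        ultimately have KW: "K \<inter> W = {0}" using t(2) by blast
        have "\<exists>J\<subseteq>I'. finite J \<and> card J \<le> card J1 + (dim U - dim W) + dim K \<and> irreducible_on (\<Union>i\<in>J. R i) U"
        proof (rule irreducible_extend[OF U(1,2) R I'(2) \<open>w0 \<in> U\<close> _ w_nz finJ1 J1I W(1,2) wW K K\<phi>])
          show "\<phi> w0 \<noteq> 0" using c(3) unfolding \<phi>_def w_def by auto
          show "w \<in> Y" if Y: "subspace Y" "Y \<subseteq> U" "stable ?R1 Y" "y \<in> Y" "\<phi> y \<noteq> 0" for Y y
          proof -
            have "scale (\<phi> y) w \<in> Y" using alg_stable[OF t(1) Y(3,1,4)] t_eq Y(2,4) by auto
            then have "scale (1 / \<phi> y) (scale (\<phi> y) w) \<in> Y" by (rule subspace_scale[OF Y(1)])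
            then show ?thesis using Y(5) by simp
          qed
          show "W \<subseteq> Y" if Y: "subspace Y" "Y \<subseteq> U" "stable ?R1 Y" "w \<in> Y" for Y
            using irreducible_onD[OF J1(3) subspace_inter[OF Y(1) W(1)] _ stable_Int[OF Y(3) stW] _ w_nz]
              Y(4) wW by blast
          show "Y \<subseteq> K" if Y: "subspace Y" "Y \<subseteq> U" "stable ?R1 Y" "\<forall>y\<in>Y. \<phi> y = 0" for Y
            using alg_stable[OF _ Y(3,1)] Y(2,4) unfolding K_def by blast
        qed
        then obtain J where J: "J \<subseteq> I'" "irreducible_on (\<Union>i\<in>J. R i) U"
          "card J \<le> card J1 + (dim U - dim W) + dim K" by blast
        have "dim K + dim W \<le> dim U" by (rule dim_add_le_if_disjoint[OF U(1) K W(1,2) KW])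
        \<comment> \<open>With \<open>p = dim W\<close> and \<open>d = dim U\<close> the count is
          \<open>(2 p - 1) + (d - p) + (d - p) = 2 d - 1\<close>.\<close>
        then have "card J \<le> 2 * dim U - 1" using J(3) J1(2) dimW by linarith
        then show ?thesis using J by blast
      next
        case False
        obtain g h where g: "g \<in> alg ?R1" "dim (g ` U) + dim W \<le> dim U"
          and h: "h \<in> ideal_gen ?R1 g" "\<And>u. u \<in> U \<Longrightarrow> h u = u"
          using low_rank_full[OF R1 U(1,2) stU W(1,2) stW J1(3) dimW] False by blast
        define S where "S = (\<lambda>i. {g \<circ> b \<circ> s \<circ> b' |b s b'. b \<in> alg ?R1 \<and> s \<in> insert id (R i) \<and> b' \<in> alg ?R1})"
        have I'ne: "I' \<noteq> {}" using a by blast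
        have h2: "\<forall>u\<in>U. h u = u" using h(2) by blast
        note cor = corner[OF U(2) R I'(2) J1I I'ne g(1) h(1) h2]
        have g_lin: "lin g" using alg_lin[OF g(1) R1] .
        have gU: "fin_dim (g ` U)" "subspace (g ` U)"
          using fin_dim_image[OF g_lin U(1)] subspace_image[OF g_lin U(2)] by auto
        have "dim (g ` U) \<noteq> 0"
        proof
          assume "dim (g ` U) = 0"
          then have "g ` U = {0}" using dim_eq_0_fin_dim[OF gU] by simp
          then have "h u \<in> {0}" if "u \<in> U" for u
            by (intro ideal_maps[OF R1 h(1) U(2) stU _ _ _ that])
              (use R1 in \<open>auto simp: stable_def lin_0\<close>)
          then show False using h(2) \<open>U \<noteq> {0}\<close> subspace_0[OF U(2)] by auto
        qed
        then have dimg: "1 \<le> dim (g ` U)" by simp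
        have lt: "dim (g ` U) < dim U" using g(2) dimW by simp
        obtain J' where J': "J' \<subseteq> I'" "card J' \<le> 2 * dim (g ` U) - 1" "irreducible_on (\<Union>i\<in>J'. S i) (g ` U)"
          using less.hyps[OF lt gU dimg fin cor(1,2)] unfolding S_def by blast
        have "irreducible_on (\<Union>i\<in>J1 \<union> J'. R i) U"
          using cor(3)[OF J'(1)] J'(3) unfolding S_def by blast
        \<comment> \<open>The induction bounds are \<open>2 p - 1\<close> and
          \<open>2 r - 1\<close>, where \<open>p = dim W\<close>, \<open>r\<close> is the rank of
          \<open>g\<close> on \<open>U\<close>, and \<open>r + p \<le> dim U\<close>.\<close>
        moreover have "card (J1 \<union> J') \<le> 2 * dim U - 1"
          using card_Un_le[of J1 J'] J1(2) J'(2) g(2) dimW dimg by linarith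
        ultimately show ?thesis using J1I J'(1) by (intro exI[of _ "J1 \<union> J'"]) auto
      qed
    qed
  qed
  then show ?case using I'(1) by blast
qed

end

section \<open>Matrix algebras\<close>

lemma unital_subalgebra_carrier: "unital_subalgebra n (carrier_mat n n)"
  unfolding unital_subalgebra_def by auto

text \<open>The hull is the intersection of all subalgebras that contain \<open>S\<close>, and the
  full matrix algebra is one of them.\<close>

lemma generates_iff:
  "generates n S \<longleftrightarrow> S \<subseteq> carrier_mat n n \<and>
     (\<forall>A. unital_subalgebra n A \<and> S \<subseteq> A \<longrightarrow> A = carrier_mat n n)"
proof
  assume g: "generates n S"
  have "A = carrier_mat n n" if "unital_subalgebra n A" "S \<subseteq> A" for A
    using g hull_minimal[where S = "unital_subalgebra n", OF that(2,1)] that(1) unfolding generates_def unital_subalgebra_def by blast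
  then show "S \<subseteq> carrier_mat n n \<and> (\<forall>A. unital_subalgebra n A \<and> S \<subseteq> A \<longrightarrow> A = carrier_mat n n)"
    using g unfolding generates_def by blast
next
  assume h: "S \<subseteq> carrier_mat n n \<and> (\<forall>A. unital_subalgebra n A \<and> S \<subseteq> A \<longrightarrow> A = carrier_mat n n)"
  then have "{A. unital_subalgebra n A \<and> S \<subseteq> A} = {carrier_mat n n}"
    using unital_subalgebra_carrier by blast
  then show "generates n S" using h unfolding generates_def hull_def by simp
qed

definition mat_unit :: "nat \<Rightarrow> nat \<Rightarrow> nat \<Rightarrow> 'a::field mat" where
  "mat_unit n i j = mat n n (\<lambda>(r, s). if r = i \<and> s = j then 1 else 0)"

lemma mat_unit_carrier [simp]: "mat_unit n i j \<in> carrier_mat n n"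
  by (simp add: mat_unit_def)

lemma mat_unit_index [simp]:
  "r < n \<Longrightarrow> s < n \<Longrightarrow> mat_unit n i j $$ (r, s) = (if r = i \<and> s = j then 1 else 0)"
  "dim_row (mat_unit n i j) = n" "dim_col (mat_unit n i j) = n"
  by (simp_all add: mat_unit_def)

lemma mat_mult_index:
  assumes "A \<in> carrier_mat n n" "B \<in> carrier_mat n n" "r < n" "s < n"
  shows "(A * B) $$ (r, s) = (\<Sum>k<n. A $$ (r, k) * B $$ (k, s))"
  using assms by (auto simp: scalar_prod_def lessThan_atLeast0 intro!: sum.cong)

lemma mat_unit_mult:
  assumes "j < n"
  shows "mat_unit n i j * mat_unit n j k = (mat_unit n i k :: 'a::field mat)"
proof (rule eq_matI)
  fix r s assume "r < dim_row (mat_unit n i k :: 'a mat)" "s < dim_col (mat_unit n i k :: 'a mat)"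
  then have rs: "r < n" "s < n" by auto
  have "(mat_unit n i j * mat_unit n j k) $$ (r, s) =
      (\<Sum>l<n. mat_unit n i j $$ (r, l) * mat_unit n j k $$ (l, s) :: 'a)"
    by (rule mat_mult_index) (use rs in auto)
  also have "\<dots> = (\<Sum>l<n. if l = j then (if r = i \<and> s = k then 1 else 0) else 0)"
    using rs by (intro sum.cong refl) auto
  finally show "(mat_unit n i j * mat_unit n j k) $$ (r, s) = (mat_unit n i k :: 'a mat) $$ (r, s)"
    using assms rs by simp
qed auto

section \<open>Spaces of functions and linear relations on matrix subalgebras\<close>

definition fun_scale :: "'a::field \<Rightarrow> ('b \<Rightarrow> 'a) \<Rightarrow> 'b \<Rightarrow> 'a" where
  "fun_scale c f = (\<lambda>x. c * f x)"

lemma fun_scale_apply [simp]: "fun_scale c f x = c * f x"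
  by (simp add: fun_scale_def)

lemma vector_space_fun_scale: "vector_space fun_scale"
  by unfold_locales (auto simp: fun_eq_iff algebra_simps)

interpretation fun_space: endo_space fun_scale
  by (intro endo_space.intro vector_space_fun_scale)

interpretation ac_fun_space: alg_closed_space fun_scale
  by (intro alg_closed_space.intro fun_space.endo_space_axioms)

lemma sum_fun_apply: "(\<Sum>i\<in>I. f i) x = (\<Sum>i\<in>I. f i x)"
  by (induction I rule: infinite_finite_induct) auto

definition unit_fun :: "'b \<Rightarrow> 'b \<Rightarrow> 'a::field" where
  "unit_fun i = (\<lambda>x. if x = i then 1 else 0)"

text \<open>A proper subspace lies in the kernel of a nonzero functional. Writing that functional in
  coordinates lets its coefficients be carried to the algebraic closure.\<close>

lemma unital_subalgebra_annihilator:
  assumes A: "unital_subalgebra n A" and proper: "A \<noteq> carrier_mat n n"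
  obtains c :: "nat \<Rightarrow> nat \<Rightarrow> 'a::field" and i0 j0
  where "i0 < n" "j0 < n" "c i0 j0 \<noteq> 0" "\<And>M. M \<in> A \<Longrightarrow> (\<Sum>i<n. \<Sum>j<n. c i j * M $$ (i, j)) = 0"
proof -
  \<comment> \<open>Matrices of size \<open>n\<close> do not fill a type that is a vector space, so
    they are embedded into functions on index pairs, with value \<open>0\<close> outside the
    range.\<close>
  define emb :: "'a mat \<Rightarrow> nat \<times> nat \<Rightarrow> 'a"
    where "emb M = (\<lambda>(i, j). if i < n \<and> j < n then M $$ (i, j) else 0)" for M
  have emb_inj: "M = N" if "M \<in> carrier_mat n n" "N \<in> carrier_mat n n" "emb M = emb N" for M N
  proof (rule eq_matI)
    fix i j assume "i < dim_row N" "j < dim_col N"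
    then show "M $$ (i, j) = N $$ (i, j)"
      using fun_cong[OF that(3), of "(i, j)"] that(2) unfolding emb_def by auto
  qed (use that in auto)
  have AC: "A \<subseteq> carrier_mat n n" using A unfolding unital_subalgebra_def by blast
  obtain M0 where M0: "M0 \<in> carrier_mat n n" "M0 \<notin> A" using proper AC by blast
  have "fun_space.subspace (emb ` A)"
    unfolding fun_space.subspace_def
  proof (intro conjI ballI allI)
    have "0 \<cdot>\<^sub>m 1\<^sub>m n \<in> A" using A unfolding unital_subalgebra_def by blast
    moreover have "emb (0 \<cdot>\<^sub>m 1\<^sub>m n) = 0" by (auto simp: emb_def fun_eq_iff)
    ultimately show "0 \<in> emb ` A" by (metis imageI)
  next
    fix x y assume "x \<in> emb ` A" "y \<in> emb ` A"
    then obtain M N where MN: "M \<in> A" "N \<in> A" "x = emb M" "y = emb N" by blast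
    then have "M \<in> carrier_mat n n" "N \<in> carrier_mat n n" "M + N \<in> A"
      using A AC unfolding unital_subalgebra_def by blast+
    then show "x + y \<in> emb ` A"
      using MN by (intro image_eqI[of _ _ "M + N"]) (auto simp: emb_def fun_eq_iff)
  next
    fix k x assume "x \<in> emb ` A"
    then obtain M where M: "M \<in> A" "x = emb M" by blast
    then have "M \<in> carrier_mat n n" "k \<cdot>\<^sub>m M \<in> A"
      using A AC unfolding unital_subalgebra_def by blast+
    then show "fun_scale k x \<in> emb ` A"
      using M by (intro image_eqI[of _ _ "k \<cdot>\<^sub>m M"]) (auto simp: emb_def fun_eq_iff)
  qed
  moreover have "emb M0 \<notin> emb ` A" using emb_inj M0 AC by blast
  ultimately obtain \<phi> :: "(nat \<times> nat \<Rightarrow> 'a) \<Rightarrow> 'a"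
    where \<phi>: "\<And>x y. \<phi> (x + y) = \<phi> x + \<phi> y" "\<And>k x. \<phi> (fun_scale k x) = k * \<phi> x"
      "\<And>x. x \<in> emb ` A \<Longrightarrow> \<phi> x = 0" "\<phi> (emb M0) = 1"
    using fun_space.exists_functional by metis
  have "fun_scale 0 0 = (0 :: nat \<times> nat \<Rightarrow> 'a)" by auto
  then have \<phi>0: "\<phi> 0 = 0" using \<phi>(2)[of 0 0] by simp
  have \<phi>_sum: "\<phi> (\<Sum>i\<in>I. f i) = (\<Sum>i\<in>I. \<phi> (f i))" for f and I :: "nat set"
  proof (induction I rule: infinite_finite_induct)
    case (infinite A)
    show ?case unfolding sum.infinite[OF infinite] by (rule \<phi>0)
  next
    case (insert x F)
    show ?case unfolding sum.insert[OF insert(1,2)] \<phi>(1) insert(3) ..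
  qed (unfold sum.empty, rule \<phi>0)
  have expand: "\<phi> (emb M) = (\<Sum>i<n. \<Sum>j<n. \<phi> (unit_fun (i, j)) * M $$ (i, j))" for M
  proof -
    have "emb M = (\<Sum>i<n. \<Sum>j<n. fun_scale (M $$ (i, j)) (unit_fun (i, j)))"
    proof
      fix p :: "nat \<times> nat"
      obtain r s where p: "p = (r, s)" by fastforce
      have "(\<Sum>j<n. M $$ (i, j) * unit_fun (i, j) p) = (if i = r \<and> s < n then M $$ (r, s) else 0)" for i
      proof -
        have "(\<Sum>j<n. M $$ (i, j) * unit_fun (i, j) p) = (\<Sum>j<n. if j = s then (if i = r then M $$ (r, s) else 0) else 0)"
          by (rule sum.cong) (auto simp: unit_fun_def p)
        then show ?thesis by auto
      qed
      then have "(\<Sum>i<n. \<Sum>j<n. fun_scale (M $$ (i, j)) (unit_fun (i, j))) p =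
          (\<Sum>i<n. if i = r then (if s < n then M $$ (r, s) else 0) else 0)"
        by (simp add: sum_fun_apply)
      then show "emb M p = (\<Sum>i<n. \<Sum>j<n. fun_scale (M $$ (i, j)) (unit_fun (i, j))) p"
        by (auto simp: emb_def p)
    qed
    then show ?thesis by (simp add: \<phi>_sum \<phi>(2) mult.commute)
  qed
  have "\<exists>i<n. \<exists>j<n. \<phi> (unit_fun (i, j)) \<noteq> 0"
  proof (rule ccontr)
    assume "\<not> ?thesis"
    then have "\<phi> (emb M0) = 0" unfolding expand by (intro sum.neutral ballI) auto
    then show False using \<phi>(4) by simp
  qed
  then obtain i0 j0 where "i0 < n" "j0 < n" "\<phi> (unit_fun (i0, j0)) \<noteq> 0" by blast
  moreover have "(\<Sum>i<n. \<Sum>j<n. \<phi> (unit_fun (i, j)) * M $$ (i, j)) = 0" if "M \<in> A" for M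
    using \<phi>(3) that unfolding expand[symmetric] by blast
  ultimately show ?thesis using that[of i0 j0 "\<lambda>i j. \<phi> (unit_fun (i, j))"] by blast
qed

text \<open>A functional that vanishes on all matrix units has only zero coefficients.\<close>

lemma unital_subalgebra_eq_carrier:
  assumes A: "unital_subalgebra n (A :: 'a::field mat set)"
    and units: "\<And>i j. i < n \<Longrightarrow> j < n \<Longrightarrow> mat_unit n i j \<in> A"
  shows "A = carrier_mat n n"
proof (rule ccontr)
  assume proper: "A \<noteq> carrier_mat n n"
  obtain c i0 j0 where c: "i0 < n" "j0 < n" "c i0 j0 \<noteq> 0"
    "\<And>M. M \<in> A \<Longrightarrow> (\<Sum>i<n. \<Sum>j<n. c i j * M $$ (i, j)) = 0"
    by (rule unital_subalgebra_annihilator[OF A proper]) blast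
  have "(\<Sum>j<n. c i j * mat_unit n i0 j0 $$ (i, j)) = (if i = i0 then c i0 j0 else 0)" if "i < n" for i
  proof -
    have "(\<Sum>j<n. c i j * mat_unit n i0 j0 $$ (i, j)) = (\<Sum>j<n. if j = j0 then (if i = i0 then c i0 j0 else 0) else 0)"
      using that by (intro sum.cong) auto
    then show ?thesis using c(2) by simp
  qed
  then have "(\<Sum>i<n. \<Sum>j<n. c i j * mat_unit n i0 j0 $$ (i, j)) = c i0 j0" using c(1) by simp
  then show False using c(3) c(4)[OF units[OF c(1,2)]] by simp
qed

text \<open>The matrices generated by finite subsets of \<open>S\<close> form a subalgebra. It
  contains the finitely many matrix units, and finitely many generators suffice for these.\<close>

lemma generates_finite_subset:
  assumes g: "generates n (S :: 'a::field mat set)"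
  obtains J where "J \<subseteq> S" "finite J" "generates n J"
proof -
  have SC: "S \<subseteq> carrier_mat n n" using g unfolding generates_iff by blast
  define gen where "gen J M \<longleftrightarrow> (\<forall>A. unital_subalgebra n A \<and> J \<subseteq> A \<longrightarrow> M \<in> A)" for J and M :: "'a mat"
  have gen_mono: "gen J' M" if "gen J M" "J \<subseteq> J'" for J J' M using that unfolding gen_def by blast
  let ?A = "{M \<in> carrier_mat n n. \<exists>J. J \<subseteq> S \<and> finite J \<and> gen J M}"
  have "unital_subalgebra n ?A"
    unfolding unital_subalgebra_def
  proof (intro conjI ballI allI)
    have "gen {} (1\<^sub>m n)" unfolding gen_def unital_subalgebra_def by blast
    then show "1\<^sub>m n \<in> ?A" by (intro CollectI conjI exI[of _ "{}"]) auto
  next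
    fix M N assume "M \<in> ?A" "N \<in> ?A"
    then obtain J K where JK: "J \<subseteq> S" "finite J" "gen J M" "K \<subseteq> S" "finite K" "gen K N"
      and MN: "M \<in> carrier_mat n n" "N \<in> carrier_mat n n" by blast
    then have JK': "gen (J \<union> K) M" "gen (J \<union> K) N" using gen_mono by blast+
    then have "gen (J \<union> K) (M + N)" "gen (J \<union> K) (M * N)" unfolding gen_def unital_subalgebra_def by blast+
    then show "M + N \<in> ?A" "M * N \<in> ?A" using JK MN by (auto intro!: exI[of _ "J \<union> K"])
  next
    fix k M assume "M \<in> ?A"
    then obtain J where J: "J \<subseteq> S" "finite J" "gen J M" "M \<in> carrier_mat n n" by blast
    then have "gen J (k \<cdot>\<^sub>m M)" unfolding gen_def unital_subalgebra_def by blast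
    then show "k \<cdot>\<^sub>m M \<in> ?A" using J by auto
  qed auto
  moreover have "S \<subseteq> ?A"
  proof
    fix M assume M: "M \<in> S"
    have "gen {M} M" unfolding gen_def by blast
    then show "M \<in> ?A" using M SC by (intro CollectI conjI exI[of _ "{M}"]) auto
  qed
  ultimately have A: "?A = carrier_mat n n" using g unfolding generates_iff by blast
  have "\<exists>J. J \<subseteq> S \<and> finite J \<and> gen J (mat_unit n i j)" for i j
    using A mat_unit_carrier[of n i j] by blast
  then obtain J where J: "\<And>i j. J i j \<subseteq> S" "\<And>i j. finite (J i j)" "\<And>i j. gen (J i j) (mat_unit n i j)"
    by metis
  let ?J = "\<Union>i<n. \<Union>j<n. J i j"
  have sub: "?J \<subseteq> S" "finite ?J" using J(1,2) by auto
  have "generates n ?J"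
    unfolding generates_iff
  proof (intro conjI allI impI)
    show "?J \<subseteq> carrier_mat n n" using sub(1) SC by blast
    fix A assume A: "unital_subalgebra n A \<and> ?J \<subseteq> A"
    show "A = carrier_mat n n"
    proof (rule unital_subalgebra_eq_carrier)
      fix i j assume "i < n" "j < n"
      then have "J i j \<subseteq> A" using A by blast
      then show "mat_unit n i j \<in> A" using J(3)[of i j] A unfolding gen_def by blast
    qed (use A in blast)
  qed
  then show ?thesis using that sub by blast
qed

section \<open>Matrices acting on coordinate vectors\<close>

text \<open>Vectors are functions on the naturals; the value \<open>0\<close> from \<open>n\<close>
  on sends everything into \<open>coord_space n\<close>, the model of \<open>F^n\<close>.\<close>

definition act :: "nat \<Rightarrow> 'a::field mat \<Rightarrow> (nat \<Rightarrow> 'a) \<Rightarrow> nat \<Rightarrow> 'a" where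
  "act n A f = (\<lambda>i. if i < n then \<Sum>j<n. A $$ (i, j) * f j else 0)"

definition coord_space :: "nat \<Rightarrow> (nat \<Rightarrow> 'a::field) set" where
  "coord_space n = {f. \<forall>i\<ge>n. f i = 0}"

lemma lin_act: "fun_space.lin (act n A)"
  by (rule fun_space.linI) (auto simp: act_def fun_eq_iff algebra_simps sum.distrib sum_distrib_left)

lemma act_in: "act n A f \<in> coord_space n"
  by (simp add: act_def coord_space_def)

lemma act_mult:
  assumes "A \<in> carrier_mat n n" "B \<in> carrier_mat n n"
  shows "act n (A * B) f = act n A (act n B f)"
proof
  fix i
  show "act n (A * B) f i = act n A (act n B f) i"
  proof (cases "i < n")
    case True
    have "(\<Sum>j<n. (A * B) $$ (i, j) * f j) = (\<Sum>j<n. \<Sum>k<n. A $$ (i, k) * B $$ (k, j) * f j)"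
      using True by (intro sum.cong refl) (simp add: mat_mult_index[OF assms] sum_distrib_right)
    also have "\<dots> = (\<Sum>k<n. \<Sum>j<n. A $$ (i, k) * B $$ (k, j) * f j)" by (rule sum.swap)
    finally show ?thesis using True by (simp add: act_def sum_distrib_left mult.assoc)
  qed (simp add: act_def)
qed

lemma act_add: "A \<in> carrier_mat n n \<Longrightarrow> B \<in> carrier_mat n n \<Longrightarrow> act n (A + B) f = act n A f + act n B f"
  by (auto simp: act_def fun_eq_iff algebra_simps sum.distrib)

lemma act_smult: "A \<in> carrier_mat n n \<Longrightarrow> act n (c \<cdot>\<^sub>m A) f = fun_scale c (act n A f)"
  by (auto simp: act_def fun_eq_iff algebra_simps sum_distrib_left)

lemma act_one: "i < n \<Longrightarrow> act n (1\<^sub>m n) f i = f i"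
proof -
  assume i: "i < n"
  have "(\<Sum>j<n. 1\<^sub>m n $$ (i, j) * f j) = (\<Sum>j<n. if j = i then f i else 0)"
    using i by (intro sum.cong) auto
  then show ?thesis using i by (simp add: act_def)
qed

lemma act_unit_fun:
  assumes "i < n" "j < n" shows "act n A (unit_fun j) i = A $$ (i, j)"
proof -
  have "(\<Sum>k<n. A $$ (i, k) * unit_fun j k) = (\<Sum>k<n. if k = j then A $$ (i, j) else 0)"
    by (rule sum.cong) (auto simp: unit_fun_def)
  then show ?thesis using assms by (simp add: act_def)
qed

lemma act_mat_unit:
  assumes "i < n" "j < n" shows "act n (mat_unit n i j) f = fun_scale (f j) (unit_fun i)"
proof
  fix r
  have "(\<Sum>k<n. mat_unit n i j $$ (r, k) * f k) = (\<Sum>k<n. if k = j then (if r = i then f j else 0) else 0)" if "r < n"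
    using that by (intro sum.cong) auto
  then show "act n (mat_unit n i j) f r = fun_scale (f j) (unit_fun i) r"
    using assms by (auto simp: act_def unit_fun_def)
qed

lemma coord_space_subspace: "fun_space.subspace (coord_space n)"
  by (auto simp: fun_space.subspace_def coord_space_def)

lemma unit_fun_in: "i < n \<Longrightarrow> unit_fun i \<in> coord_space n"
  by (auto simp: unit_fun_def coord_space_def)

lemma unit_fun_nonzero: "unit_fun i \<noteq> (0 :: 'b \<Rightarrow> 'a::field)"
proof
  assume "unit_fun i = (0 :: 'b \<Rightarrow> 'a)"
  from fun_cong[OF this, of i] show False by (simp add: unit_fun_def)
qed

lemma coord_space_span: "coord_space n \<subseteq> fun_space.span (unit_fun ` {..<n})"
proof
  fix f :: "nat \<Rightarrow> 'a" assume f: "f \<in> coord_space n"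
  have "f = (\<Sum>i<n. fun_scale (f i) (unit_fun i))"
  proof
    fix x
    have "(\<Sum>i<n. f i * unit_fun i x) = (\<Sum>i<n. if i = x then f x else 0)"
      by (rule sum.cong) (auto simp: unit_fun_def)
    then show "f x = (\<Sum>i<n. fun_scale (f i) (unit_fun i)) x"
      using f by (auto simp: sum_fun_apply coord_space_def)
  qed
  also have "\<dots> \<in> fun_space.span (unit_fun ` {..<n})"
    by (intro fun_space.span_sum fun_space.span_scale fun_space.span_base) auto
  finally show "f \<in> fun_space.span (unit_fun ` {..<n})" .
qed

lemma coord_space_fin_dim: "fun_space.fin_dim (coord_space n)"
  unfolding fun_space.fin_dim_def using coord_space_span by blast

lemma coord_space_dim_le: "fun_space.dim (coord_space n :: (nat \<Rightarrow> 'a::field) set) \<le> n"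
proof -
  have "fun_space.dim (coord_space n :: (nat \<Rightarrow> 'a) set) \<le> card (unit_fun ` {..<n} :: (nat \<Rightarrow> 'a) set)"
    by (rule fun_space.dim_le_card[OF coord_space_span]) simp
  also have "\<dots> \<le> n" using card_image_le[of "{..<n}" unit_fun] by simp
  finally show ?thesis .
qed

section \<open>Generation over the field and irreducibility over its algebraic closure\<close>

abbreviation to_ac_mat :: "'a::field mat \<Rightarrow> 'a alg_closure mat" where
  "to_ac_mat \<equiv> map_mat to_ac"

lemma to_ac_mat_mult:
  assumes "A \<in> carrier_mat n n" "B \<in> carrier_mat n n"
  shows "to_ac_mat (A * B) = to_ac_mat A * to_ac_mat B"
proof (rule eq_matI)
  fix r s assume "r < dim_row (to_ac_mat A * to_ac_mat B)" "s < dim_col (to_ac_mat A * to_ac_mat B)"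
  then have rs: "r < n" "s < n" using assms by auto
  then show "to_ac_mat (A * B) $$ (r, s) = (to_ac_mat A * to_ac_mat B) $$ (r, s)"
    using assms mat_mult_index[of "to_ac_mat A" n "to_ac_mat B" r s] mat_mult_index[OF assms rs]
    by (simp add: to_ac_sum)
qed (use assms in auto)

text \<open>The matrices over the ground field whose extension preserves \<open>W\<close> form a
  subalgebra containing \<open>S\<close>, so they are all matrices. The matrix units among them
  carry a nonzero vector of \<open>W\<close> to nonzero multiples of every basis vector.\<close>

lemma generates_imp_irreducible:
  assumes g: "generates n (S :: 'a::field mat set)"
  shows "fun_space.irreducible_on ((\<lambda>A. act n (to_ac_mat A)) ` S) (coord_space n)"
  unfolding fun_space.irreducible_on_def
proof (intro allI impI)
  fix W :: "(nat \<Rightarrow> 'a alg_closure) set"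
  assume "fun_space.subspace W \<and> W \<subseteq> coord_space n \<and>
    fun_space.stable ((\<lambda>A. act n (to_ac_mat A)) ` S) W"
  then have W: "fun_space.subspace W" "W \<subseteq> coord_space n"
    "fun_space.stable ((\<lambda>A. act n (to_ac_mat A)) ` S) W" by auto
  have SC: "S \<subseteq> carrier_mat n n" using g unfolding generates_iff by blast
  let ?A = "{A \<in> carrier_mat n n. \<forall>f\<in>W. act n (to_ac_mat A) f \<in> W}"
  have "unital_subalgebra n ?A"
    unfolding unital_subalgebra_def
  proof (intro conjI ballI allI)
    have "act n (to_ac_mat (1\<^sub>m n)) f = f" if "f \<in> W" for f
    proof
      fix i
      have "to_ac_mat (1\<^sub>m n) = (1\<^sub>m n :: 'a alg_closure mat)" by (rule eq_matI) auto
      then show "act n (to_ac_mat (1\<^sub>m n)) f i = f i"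
        using act_one[of i n f] W(2) that by (cases "i < n") (auto simp: act_def coord_space_def)
    qed
    then show "1\<^sub>m n \<in> ?A" by simp
  next
    fix A B assume "A \<in> ?A" "B \<in> ?A"
    then have AB: "A \<in> carrier_mat n n" "B \<in> carrier_mat n n"
      and st: "\<And>f. f \<in> W \<Longrightarrow> act n (to_ac_mat A) f \<in> W" "\<And>f. f \<in> W \<Longrightarrow> act n (to_ac_mat B) f \<in> W"
      by auto
    have AB': "to_ac_mat A \<in> carrier_mat n n" "to_ac_mat B \<in> carrier_mat n n" using AB by auto
    have "to_ac_mat (A + B) = to_ac_mat A + to_ac_mat B" using AB by (intro eq_matI) auto
    then show "A + B \<in> ?A"
      using AB st fun_space.subspace_add[OF W(1)] by (simp add: act_add[OF AB'])
    show "A * B \<in> ?A" using AB st by (simp add: to_ac_mat_mult[OF AB] act_mult[OF AB'])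
  next
    fix k A assume "A \<in> ?A"
    then have A: "A \<in> carrier_mat n n" and st: "\<And>f. f \<in> W \<Longrightarrow> act n (to_ac_mat A) f \<in> W" by auto
    have A': "to_ac_mat A \<in> carrier_mat n n" using A by auto
    have "to_ac_mat (k \<cdot>\<^sub>m A) = to_ac k \<cdot>\<^sub>m to_ac_mat A" using A by (intro eq_matI) auto
    then show "k \<cdot>\<^sub>m A \<in> ?A"
      using A st fun_space.subspace_scale[OF W(1)] by (simp add: act_smult[OF A'])
  qed auto
  moreover have "S \<subseteq> ?A" using SC W(3) unfolding fun_space.stable_def by blast
  ultimately have A: "?A = carrier_mat n n" using g unfolding generates_iff by blast
  have units: "fun_scale (f j) (unit_fun i) \<in> W" if "i < n" "j < n" "f \<in> W" for i j f
  proof -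
    have "to_ac_mat (mat_unit n i j :: 'a mat) = mat_unit n i j" by (rule eq_matI) auto
    moreover have "(mat_unit n i j :: 'a mat) \<in> ?A" unfolding A by simp
    ultimately show ?thesis using that(3) act_mat_unit[OF that(1,2), of f] by auto
  qed
  show "W = {0} \<or> W = coord_space n"
  proof (cases "W = {0}")
    case False
    then obtain f where f: "f \<in> W" "f \<noteq> 0" using fun_space.subspace_0[OF W(1)] by blast
    then obtain j where j: "f j \<noteq> 0" by (auto simp: fun_eq_iff)
    have "f \<in> coord_space n" using f(1) W(2) by blast
    then have "j < n" using j by (cases "j < n") (auto simp: coord_space_def)
    have "unit_fun i \<in> W" if "i < n" for i
    proof -
      note u = units[OF that \<open>j < n\<close> f(1)]
      have "fun_scale (1 / f j) (fun_scale (f j) (unit_fun i)) \<in> W"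
        by (rule fun_space.subspace_scale[OF W(1) u])
      moreover have "fun_scale (1 / f j) (fun_scale (f j) g) = g" for g :: "nat \<Rightarrow> 'a alg_closure"
        unfolding fun_scale_def using j by simp
      ultimately show ?thesis by (simp only:)
    qed
    then have "fun_space.span (unit_fun ` {..<n}) \<subseteq> W" using W(1) by (intro fun_space.span_minimal) auto
    then show ?thesis using coord_space_span W(2) by blast
  qed simp
qed

text \<open>If the subalgebra generated by \<open>J\<close> were proper, a linear relation with coefficients in the ground
  field would hold for its members, hence for everything generated by \<open>J\<close> over the algebraic closure,
  which contradicts density.\<close>

lemma irreducible_imp_generates:
  assumes JC: "J \<subseteq> carrier_mat n (n :: nat)"
    and irr: "fun_space.irreducible_on ((\<lambda>A. act n (to_ac_mat A)) ` J) (coord_space n)"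
  shows "generates n (J :: 'a::field mat set)"
  unfolding generates_iff
proof (intro conjI allI impI JC)
  fix A assume "unital_subalgebra n A \<and> J \<subseteq> A"
  then have A: "unital_subalgebra n A" "J \<subseteq> A" by auto
  have AC: "A \<subseteq> carrier_mat n n" using A(1) unfolding unital_subalgebra_def by blast
  let ?R = "(\<lambda>A. act n (to_ac_mat A)) ` J" and ?U = "coord_space n :: (nat \<Rightarrow> 'a alg_closure) set"
  have R: "\<forall>f\<in>?R. fun_space.lin f" using lin_act by blast
  show "A = carrier_mat n n"
  proof (rule ccontr)
    assume proper: "A \<noteq> carrier_mat n n"
    obtain c i0 j0 where c: "i0 < n" "j0 < n" "c i0 j0 \<noteq> 0"
      "\<And>M. M \<in> A \<Longrightarrow> (\<Sum>i<n. \<Sum>j<n. c i j * M $$ (i, j)) = 0"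
      by (rule unital_subalgebra_annihilator[OF A(1) proper]) blast
    \<comment> \<open>The relation is strengthened to products of a matrix \<open>M\<close> in
      \<open>A\<close> with \<open>h\<close>, so that a generator split off from the left of
      \<open>h\<close> can be absorbed into \<open>M\<close>.\<close>
    have rel: "(\<Sum>i<n. \<Sum>j<n. to_ac (c i j) * act n (to_ac_mat M) (h (unit_fun j)) i) = 0"
      if "h \<in> fun_space.alg ?R" "M \<in> A" for h M
      using that
    proof (induction arbitrary: M rule: fun_space.alg.induct)
      case alg_id
      have "(\<Sum>i<n. \<Sum>j<n. to_ac (c i j) * act n (to_ac_mat M) (id (unit_fun j)) i) =
          (\<Sum>i<n. \<Sum>j<n. to_ac (c i j * M $$ (i, j)))"
        using alg_id AC by (intro sum.cong refl) (auto simp: act_unit_fun)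
      also have "\<dots> = to_ac (\<Sum>i<n. \<Sum>j<n. c i j * M $$ (i, j))" by (simp add: to_ac_sum)
      finally show ?case using c(4)[OF alg_id] by simp
    next
      case (alg_step h f)
      obtain N where N: "N \<in> J" "f = act n (to_ac_mat N)" using alg_step by blast
      then have "N \<in> A" using A(2) by blast
      then have MN: "M * N \<in> A" "M \<in> carrier_mat n n" "N \<in> carrier_mat n n"
        using A(1) AC alg_step(4) unfolding unital_subalgebra_def by blast+
      have "act n (to_ac_mat (M * N)) v = act n (to_ac_mat M) (f v)" for v
        using MN by (simp add: N(2) to_ac_mat_mult[OF MN(2,3)] act_mult[of _ n])
      then show ?case using alg_step.IH[OF MN(1)] by simp
    next
      case (alg_plus h h')
      have "act n N (h e + h' e) i = act n N (h e) i + act n N (h' e) i" for N e i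
        by (subst fun_space.lin_add[OF lin_act]) (rule plus_fun_apply)
      then show ?case
        by (simp only: distrib_left sum.distrib alg_plus.IH[OF alg_plus.prems] add_0_left)
    next
      case (alg_scale h k)
      have "(\<Sum>i<n. \<Sum>j<n. to_ac (c i j) * act n (to_ac_mat M) (fun_scale k (h (unit_fun j))) i) =
          k * (\<Sum>i<n. \<Sum>j<n. to_ac (c i j) * act n (to_ac_mat M) (h (unit_fun j)) i)"
        by (simp add: fun_space.lin_scale[OF lin_act] sum_distrib_left algebra_simps)
      then show ?case by (simp only: alg_scale.IH[OF alg_scale.prems] mult_zero_right)
    qed
    let ?E = "mat_unit n i0 j0 :: 'a alg_closure mat"
    have st: "fun_space.stable ?R ?U" unfolding fun_space.stable_def using act_in by blast
    have u0: "unit_fun i0 \<in> ?U" "unit_fun i0 \<noteq> (0 :: nat \<Rightarrow> 'a alg_closure)"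
      by (rule unit_fun_in[OF c(1)], rule unit_fun_nonzero)
    \<comment> \<open>Density realises the matrix unit at the place where \<open>c\<close> is
      nonzero; with the identity for \<open>M\<close> the relation then reads
      \<open>to_ac (c i0 j0) = 0\<close>.\<close>
    obtain h where h: "h \<in> fun_space.ideal_gen ?R id" "\<And>f. f \<in> ?U \<Longrightarrow> h f = act n ?E f"
      by (rule ac_fun_space.density[OF R coord_space_fin_dim coord_space_subspace st irr
            fun_space.alg_id u0(1) _ lin_act])
        (use u0 act_in in auto)
    have h_alg: "h \<in> fun_space.alg ?R" by (rule fun_space.ideal_alg[OF R fun_space.alg_id h(1)])
    have one: "1\<^sub>m n \<in> A" using A(1) unfolding unital_subalgebra_def by blast
    have one': "to_ac_mat (1\<^sub>m n) = (1\<^sub>m n :: 'a alg_closure mat)" by (rule eq_matI) auto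
    have "0 = (\<Sum>i<n. \<Sum>j<n. to_ac (c i j) * act n (to_ac_mat (1\<^sub>m n)) (h (unit_fun j)) i)"
      using rel[OF h_alg one] by simp
    also have "\<dots> = (\<Sum>i<n. \<Sum>j<n. to_ac (c i j) * (if i = i0 \<and> j = j0 then 1 else 0))"
      by (intro sum.cong refl) (simp add: one' act_one h(2) unit_fun_in act_unit_fun)
    also have "\<dots> = (\<Sum>i<n. if i = i0 then to_ac (c i0 j0) else 0)"
    proof (rule sum.cong)
      fix i
      have "(\<Sum>j<n. to_ac (c i j) * (if i = i0 \<and> j = j0 then 1 else 0)) =
          (\<Sum>j<n. if j = j0 then (if i = i0 then to_ac (c i0 j0) else 0) else 0)"
        by (rule sum.cong) auto
      then show "(\<Sum>j<n. to_ac (c i j) * (if i = i0 \<and> j = j0 then 1 else 0)) =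
          (if i = i0 then to_ac (c i0 j0) else 0)" using c(2) by simp
    qed simp
    also have "\<dots> = to_ac (c i0 j0)" using c(1) by simp
    finally show False using c(3) by simp
  qed
qed

text \<open>The family is indexed by the matrices themselves, with one map for each, so the chosen
  index set is a subset of \<open>S\<close>.\<close>

lemma generates_small_subset:
  assumes "n > 0" "finite S" and g: "generates n (S :: 'a::field mat set)"
  obtains J where "J \<subseteq> S" "card J \<le> 2 * n - 1" "generates n J"
proof -
  let ?U = "coord_space n :: (nat \<Rightarrow> 'a alg_closure) set"
  let ?R = "\<lambda>A :: 'a mat. {act n (to_ac_mat A)}"
  have R_eq: "(\<Union>A\<in>J. ?R A) = (\<lambda>A. act n (to_ac_mat A)) ` J" for J by auto
  have irr: "fun_space.irreducible_on (\<Union>A\<in>S. ?R A) ?U"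
    unfolding R_eq by (rule generates_imp_irreducible[OF g])
  have "fun_space.dim ?U \<noteq> 0"
  proof
    assume "fun_space.dim ?U = 0"
    then have "?U = {0}"
      by (rule fun_space.dim_eq_0_fin_dim[OF coord_space_fin_dim coord_space_subspace, THEN iffD1])
    moreover have "unit_fun 0 \<in> ?U" by (rule unit_fun_in[OF assms(1)])
    moreover have "unit_fun 0 \<noteq> (0 :: nat \<Rightarrow> 'a alg_closure)" by (rule unit_fun_nonzero)
    ultimately show False by simp
  qed
  then have dim1: "1 \<le> fun_space.dim ?U" by simp
  have R: "\<forall>A\<in>S. \<forall>f\<in>?R A. fun_space.lin f \<and> f ` ?U \<subseteq> ?U" using lin_act act_in by auto
  obtain J where J: "J \<subseteq> S" "card J \<le> 2 * fun_space.dim ?U - 1"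
    "fun_space.irreducible_on (\<Union>A\<in>J. ?R A) ?U"
    using ac_fun_space.irreducible_subfamily[OF coord_space_fin_dim coord_space_subspace dim1 assms(2) R irr]
    by blast
  have "card J \<le> 2 * n - 1" using J(2) coord_space_dim_le[of n, where ?'a = "'a alg_closure"] by linarith
  moreover have "generates n J"
  proof (rule irreducible_imp_generates)
    show "J \<subseteq> carrier_mat n n" using J(1) g unfolding generates_iff by blast
  qed (use J(3) in \<open>unfold R_eq\<close>)
  ultimately show ?thesis using that J(1) by blast
qed

lemma irredundant_card_le:
  assumes "n > 0" and S: "irredundant_generating_set n (S :: 'a::field mat set)"
  shows "finite S \<and> card S \<le> 2 * n - 1"
proof -
  have g: "generates n S" and irr: "\<And>T. T \<subset> S \<Longrightarrow> \<not> generates n T"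
    using S unfolding irredundant_generating_set_def by auto
  obtain J where "J \<subseteq> S" "finite J" "generates n J" by (rule generates_finite_subset[OF g])
  \<comment> \<open>Finiteness comes first: \<open>generates_small_subset\<close> asks for it, and
    since an infinite set has \<open>card\<close> zero the bound alone would say nothing about such
    a set.\<close>
  then have fin: "finite S" using irr by blast
  obtain K where "K \<subseteq> S" "card K \<le> 2 * n - 1" "generates n K"
    by (rule generates_small_subset[OF assms(1) fin g])
  then show ?thesis using irr fin by blast
qed

section \<open>The explicit irredundant generating set\<close>

text \<open>The condition on \<open>A\<close> says that it preserves the span of the basis vectors
  with index outside \<open>Q\<close>.\<close>

lemma zero_block_subalgebra:
  "unital_subalgebra n {A \<in> carrier_mat n n. \<forall>r<n. \<forall>s<n. r \<in> Q \<longrightarrow> s \<notin> Q \<longrightarrow> A $$ (r, s) = (0 :: 'a::field)}"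
  (is "unital_subalgebra n ?A")
  unfolding unital_subalgebra_def
proof (intro conjI ballI allI)
  fix A B assume "A \<in> ?A" "B \<in> ?A"
  then have AB: "A \<in> carrier_mat n n" "B \<in> carrier_mat n n"
    and z: "\<And>r s. r < n \<Longrightarrow> s < n \<Longrightarrow> r \<in> Q \<Longrightarrow> s \<notin> Q \<Longrightarrow> A $$ (r, s) = 0"
      "\<And>r s. r < n \<Longrightarrow> s < n \<Longrightarrow> r \<in> Q \<Longrightarrow> s \<notin> Q \<Longrightarrow> B $$ (r, s) = 0" by auto
  show "A + B \<in> ?A" using AB z by auto
  have "(A * B) $$ (r, s) = 0" if "r < n" "s < n" "r \<in> Q" "s \<notin> Q" for r s
    unfolding mat_mult_index[OF AB that(1,2)]
  proof (intro sum.neutral ballI)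
    fix k assume "k \<in> {..<n}"
    then show "A $$ (r, k) * B $$ (k, s) = 0" using z that by (cases "k \<in> Q") auto
  qed
  then show "A * B \<in> ?A" using AB by auto
qed auto

text \<open>These matrices have the all-ones vector as an eigenvector, with the common row sum as
  eigenvalue; such eigenvalues add and multiply.\<close>

lemma row_sum_subalgebra:
  "unital_subalgebra n {A \<in> carrier_mat n n. \<exists>l. \<forall>r<n. (\<Sum>s<n. A $$ (r, s)) = (l :: 'a::field)}"
  (is "unital_subalgebra n ?A")
  unfolding unital_subalgebra_def
proof (intro conjI ballI allI)
  have "(\<Sum>s<n. 1\<^sub>m n $$ (r, s)) = (1 :: 'a)" if "r < n" for r
  proof -
    have "(\<Sum>s<n. 1\<^sub>m n $$ (r, s)) = (\<Sum>s<n. if s = r then 1 else (0 :: 'a))"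
      using that by (intro sum.cong) auto
    then show ?thesis using that by simp
  qed
  then show "1\<^sub>m n \<in> ?A" by auto
next
  fix A B assume "A \<in> ?A" "B \<in> ?A"
  then obtain k l where AB: "A \<in> carrier_mat n n" "B \<in> carrier_mat n n"
    and kl: "\<And>r. r < n \<Longrightarrow> (\<Sum>s<n. A $$ (r, s)) = k" "\<And>r. r < n \<Longrightarrow> (\<Sum>s<n. B $$ (r, s)) = l" by blast
  have "(\<Sum>s<n. (A + B) $$ (r, s)) = k + l" if "r < n" for r
    using AB that by (simp add: kl[symmetric] sum.distrib)
  then show "A + B \<in> ?A" using AB by auto
  have "(\<Sum>s<n. (A * B) $$ (r, s)) = k * l" if "r < n" for r
  proof -
    have "(\<Sum>s<n. (A * B) $$ (r, s)) = (\<Sum>s<n. \<Sum>m<n. A $$ (r, m) * B $$ (m, s))"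
      using that by (intro sum.cong refl) (simp add: mat_mult_index[OF AB])
    also have "\<dots> = (\<Sum>m<n. A $$ (r, m) * (\<Sum>s<n. B $$ (m, s)))"
      by (subst sum.swap) (simp add: sum_distrib_left)
    also have "\<dots> = (\<Sum>m<n. A $$ (r, m)) * l" by (simp add: kl(2) sum_distrib_right)
    finally show ?thesis using kl(1) that by simp
  qed
  then show "A * B \<in> ?A" using AB by auto
next
  fix c A assume "A \<in> ?A"
  then obtain k where A: "A \<in> carrier_mat n n" and k: "\<And>r. r < n \<Longrightarrow> (\<Sum>s<n. A $$ (r, s)) = k" by blast
  have "(\<Sum>s<n. (c \<cdot>\<^sub>m A) $$ (r, s)) = c * k" if "r < n" for r
    using A that by (simp add: k[symmetric] sum_distrib_left)
  then show "c \<cdot>\<^sub>m A \<in> ?A" using A by auto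
qed auto

text \<open>For \<open>i < n - 1\<close> the diagonal entry makes every row sum zero, so the matrix
  fits \<open>row_sum_subalgebra\<close>; the off-diagonal entry is the one that violates a block
  condition.\<close>

definition lower_gen :: "nat \<Rightarrow> nat \<Rightarrow> 'a::field mat" where
  "lower_gen n i = mat_unit n (Suc i) (Suc i) + (-1) \<cdot>\<^sub>m mat_unit n (Suc i) i"

text \<open>Note that \<open>upper_gen n (n - 1)\<close> is the matrix unit \<open>mat_unit n (n - 1) (n - 1)\<close>, since
  \<open>mat_unit n i n\<close> is zero.\<close>

definition upper_gen :: "nat \<Rightarrow> nat \<Rightarrow> 'a::field mat" where
  "upper_gen n i = mat_unit n i i + (-1) \<cdot>\<^sub>m mat_unit n i (Suc i)"

lemma gen_carrier [simp]: "lower_gen n i \<in> carrier_mat n n" "upper_gen n i \<in> carrier_mat n n"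
  by (simp_all add: lower_gen_def upper_gen_def)

lemma gen_index:
  assumes "r < n" "s < n"
  shows "lower_gen n i $$ (r, s) =
      (if r = Suc i then (if s = Suc i then 1 else if s = i then -1 else 0) else (0 :: 'a::field))"
    and "upper_gen n i $$ (r, s) =
      (if r = i then (if s = i then 1 else if s = Suc i then -1 else 0) else (0 :: 'a))"
  using assms by (auto simp: lower_gen_def upper_gen_def)

text \<open>The last upper generator is a diagonal unit. From the unit at \<open>Suc i\<close>,
  multiplying \<open>upper_gen n i\<close> by it on the right gives the unit at
  \<open>(i, Suc i)\<close> up to sign, and linear combinations give those at \<open>(i, i)\<close>
  and \<open>(Suc i, i)\<close>; products of neighbours give the rest.\<close>

lemma gens_generate:
  assumes n: "n > 0"
  shows "generates n (lower_gen n ` {..<n - 1} \<union> upper_gen n ` {..<n} :: 'a::field mat set)"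
  unfolding generates_iff
proof (intro conjI allI impI)
  fix A :: "'a mat set"
  assume "unital_subalgebra n A \<and> lower_gen n ` {..<n - 1} \<union> upper_gen n ` {..<n} \<subseteq> A"
  then have A: "unital_subalgebra n A" and lo: "\<And>i. i < n - 1 \<Longrightarrow> lower_gen n i \<in> A"
    and up: "\<And>i. i < n \<Longrightarrow> upper_gen n i \<in> A" by auto
  have add: "M + N \<in> A" and mult: "M * N \<in> A" and smult: "k \<cdot>\<^sub>m M \<in> A" if "M \<in> A" "N \<in> A" for M N k
    using A that unfolding unital_subalgebra_def by blast+
  have step: "mat_unit n i i \<in> A" "mat_unit n i (Suc i) \<in> A" "mat_unit n (Suc i) i \<in> A"
    if "mat_unit n (Suc i) (Suc i) \<in> A" "i < n - 1" for i
  proof -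
    have "upper_gen n i * mat_unit n (Suc i) (Suc i) = ((-1) \<cdot>\<^sub>m mat_unit n i (Suc i) :: 'a mat)"
    proof (rule eq_matI)
      fix r s assume "r < dim_row ((-1) \<cdot>\<^sub>m mat_unit n i (Suc i) :: 'a mat)"
        "s < dim_col ((-1) \<cdot>\<^sub>m mat_unit n i (Suc i) :: 'a mat)"
      then have rs: "r < n" "s < n" by auto
      have "(upper_gen n i * mat_unit n (Suc i) (Suc i)) $$ (r, s) =
          (\<Sum>k<n. upper_gen n i $$ (r, k) * mat_unit n (Suc i) (Suc i) $$ (k, s) :: 'a)"
        by (rule mat_mult_index) (use rs in auto)
      also have "\<dots> = (\<Sum>k<n. if k = Suc i then (if r = i \<and> s = Suc i then - 1 else 0) else 0)"
        using rs by (intro sum.cong refl) (auto simp: gen_index)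
      finally show "(upper_gen n i * mat_unit n (Suc i) (Suc i)) $$ (r, s) =
          ((-1) \<cdot>\<^sub>m mat_unit n i (Suc i) :: 'a mat) $$ (r, s)"
        using rs that(2) by simp
    qed (auto simp: upper_gen_def)
    moreover have "(-1) \<cdot>\<^sub>m ((-1) \<cdot>\<^sub>m mat_unit n i (Suc i)) = (mat_unit n i (Suc i) :: 'a mat)"
      by (rule eq_matI) auto
    ultimately show u: "mat_unit n i (Suc i) \<in> A"
      using smult mult that up[of i] by (metis Suc_lessD less_diff_conv plus_1_eq_Suc add.commute)
    have "upper_gen n i + mat_unit n i (Suc i) = (mat_unit n i i :: 'a mat)"
      by (rule eq_matI) (auto simp: upper_gen_def)
    then show "mat_unit n i i \<in> A" using add[OF up u, of i] that(2) by simp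
    have "mat_unit n (Suc i) (Suc i) + (-1) \<cdot>\<^sub>m lower_gen n i = (mat_unit n (Suc i) i :: 'a mat)"
      by (rule eq_matI) (auto simp: lower_gen_def)
    then show "mat_unit n (Suc i) i \<in> A"
      using add[OF that(1) smult[OF lo lo, of i i "-1"]] that(2) by simp
  qed
  \<comment> \<open>The induction runs downward from the last diagonal place, with \<open>k\<close>
    the distance to it.\<close>
  have diag: "mat_unit n (n - 1 - k) (n - 1 - k) \<in> A" if "k < n" for k
    using that
  proof (induction k)
    case 0
    have "upper_gen n (n - 1) = (mat_unit n (n - 1) (n - 1) :: 'a mat)"
      by (rule eq_matI) (auto simp: upper_gen_def)
    then show ?case using up[of "n - 1"] n by simp
  next
    case (Suc k)
    then have "Suc (n - 1 - Suc k) = n - 1 - k" by simp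
    then show ?case using step(1)[of "n - 1 - Suc k"] Suc by simp
  qed
  have diag': "mat_unit n i i \<in> A" if "i < n" for i
    using diag[of "n - 1 - i"] that by simp
  have above: "mat_unit n i (i + k) \<in> A \<and> mat_unit n (i + k) i \<in> A" if "i + k < n" for i k
    using that
  proof (induction k)
    case 0
    then show ?case using diag' by simp
  next
    case (Suc k)
    then have IH: "mat_unit n i (i + k) \<in> A" "mat_unit n (i + k) i \<in> A"
      and ik: "Suc (i + k) < n" "i + k < n" "i + k < n - 1" by auto
    have "mat_unit n i (i + k) * mat_unit n (i + k) (Suc (i + k)) = (mat_unit n i (Suc (i + k)) :: 'a mat)"
      "mat_unit n (Suc (i + k)) (i + k) * mat_unit n (i + k) i = (mat_unit n (Suc (i + k)) i :: 'a mat)"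
      using ik by (auto intro: mat_unit_mult)
    then show ?case
      using mult[OF IH(1) step(2)[OF diag'[OF ik(1)] ik(3)]] mult[OF step(3)[OF diag'[OF ik(1)] ik(3)] IH(2)]
      by simp
  qed
  show "A = carrier_mat n n"
  proof (rule unital_subalgebra_eq_carrier[OF A])
    fix i j assume "i < n" "j < n"
    then show "mat_unit n i j \<in> A"
      using above[of i "j - i"] above[of j "i - j"] by (cases "i \<le> j") auto
  qed
qed auto

text \<open>The subalgebras omit one generator each: they are the stabilisers of the span of the first \<open>i + 1\<close>
  basis vectors, of the span of the remaining ones, and of the all-ones vector.\<close>

lemma gens_separated:
  assumes n: "n > 1" and k: "k \<in> {..<n - 1} <+> {..<n}"
  shows "\<exists>A. unital_subalgebra n A \<and> case_sum (lower_gen n) (upper_gen n) k \<notin> (A :: 'a::field mat set) \<and>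
    (\<forall>l \<in> {..<n - 1} <+> {..<n}. l \<noteq> k \<longrightarrow> case_sum (lower_gen n) (upper_gen n) l \<in> A)"
proof -
  let ?x = "case_sum (lower_gen n) (upper_gen n) :: nat + nat \<Rightarrow> 'a mat"
  let ?Z = "\<lambda>Q. {A \<in> carrier_mat n n. \<forall>r<n. \<forall>s<n. r \<in> Q \<longrightarrow> s \<notin> Q \<longrightarrow> A $$ (r, s) = (0 :: 'a)}"
  consider (lo) i where "k = Inl i" "i < n - 1" | (up) i where "k = Inr i" "i < n - 1" | (last) "k = Inr (n - 1)"
    using k by (auto simp: less_Suc_eq) linarith
  then show ?thesis
  proof cases
    case lo
    have "lower_gen n i $$ (Suc i, i) = (-1 :: 'a)" using lo(2) by (simp add: gen_index)
    then have "\<not> (\<forall>r<n. \<forall>s<n. r \<in> {i<..} \<longrightarrow> s \<notin> {i<..} \<longrightarrow> lower_gen n i $$ (r, s) = (0 :: 'a))"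
      using lo(2) by (intro notI) (drule spec[of _ "Suc i"], drule mp, simp, drule spec[of _ i], simp)
    then have "lower_gen n i \<notin> ?Z {i<..}" by blast
    moreover have "?x l \<in> ?Z {i<..}" if "l \<noteq> k" for l
      using that lo(1) by (auto simp: gen_index split: sum.split)
    ultimately show ?thesis
      using lo(1) by (intro exI[of _ "?Z {i<..}"] conjI zero_block_subalgebra) auto
  next
    case up
    have "upper_gen n i $$ (i, Suc i) = (-1 :: 'a)" using up(2) by (simp add: gen_index)
    then have "\<not> (\<forall>r<n. \<forall>s<n. r \<in> {..i} \<longrightarrow> s \<notin> {..i} \<longrightarrow> upper_gen n i $$ (r, s) = (0 :: 'a))"
      using up(2) by (intro notI) (drule spec[of _ i], drule mp, simp, drule spec[of _ "Suc i"], simp)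
    then have "upper_gen n i \<notin> ?Z {..i}" by blast
    moreover have "?x l \<in> ?Z {..i}" if "l \<noteq> k" for l
      using that up(1) by (auto simp: gen_index split: sum.split)
    ultimately show ?thesis
      using up(1) by (intro exI[of _ "?Z {..i}"] conjI zero_block_subalgebra) auto
  next
    case last
    let ?A = "{A \<in> carrier_mat n n. \<exists>l. \<forall>r<n. (\<Sum>s<n. A $$ (r, s)) = (l :: 'a)}"
    have lo_sum: "(\<Sum>s<n. lower_gen n i $$ (r, s)) = (0 :: 'a)" if "r < n" "i < n - 1" for r i
    proof -
      have "(\<Sum>s<n. lower_gen n i $$ (r, s)) =
          (\<Sum>s<n. (if s = Suc i then (if r = Suc i then 1 else 0) else (0 :: 'a)) +
            (if s = i then (if r = Suc i then -1 else 0) else 0))"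
        using that by (intro sum.cong) (auto simp: gen_index)
      then show ?thesis using that by (simp add: sum.distrib)
    qed
    have up_sum: "(\<Sum>s<n. upper_gen n i $$ (r, s)) =
        (if r = i then 1 else 0) + (if r = i \<and> Suc i < n then -1 else (0 :: 'a))" if "r < n" "i < n" for r i
    proof -
      have "(\<Sum>s<n. upper_gen n i $$ (r, s)) =
          (\<Sum>s<n. (if s = i then (if r = i then 1 else 0) else (0 :: 'a)) +
            (if s = Suc i then (if r = i then -1 else 0) else 0))"
        using that by (intro sum.cong) (auto simp: gen_index)
      then show ?thesis using that by (simp add: sum.distrib)
    qed
    have "?x k \<notin> ?A"
    proof
      assume "?x k \<in> ?A"
      then obtain l where l: "\<And>r. r < n \<Longrightarrow> (\<Sum>s<n. upper_gen n (n - 1) $$ (r, s)) = (l :: 'a)"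
        unfolding last by auto
      \<comment> \<open>Row \<open>n - 1\<close> sums to one and row \<open>0\<close> to zero, and
        these are different rows because \<open>n > 1\<close>.\<close>
      show False using l[of 0] l[of "n - 1"] n by (simp add: up_sum)
    qed
    moreover have "?x l \<in> ?A" if "l \<in> {..<n - 1} <+> {..<n}" "l \<noteq> k" for l
    proof (cases l)
      case (Inl i)
      then have "i < n - 1" using that(1) by auto
      then show ?thesis using Inl lo_sum by auto
    next
      case (Inr i)
      then have "i < n" "i \<noteq> n - 1" using that unfolding last by auto
      then have "i < n" "Suc i < n" by auto
      then show ?thesis using Inr up_sum[of _ i] by (auto intro!: exI[of _ 0])
    qed
    ultimately show ?thesis by (intro exI[of _ ?A] conjI row_sum_subalgebra) auto
  qed
qed

text \<open>Indexing by a disjoint sum counts \<open>2 n - 1\<close> generators. Separation gives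
  irredundancy and also injectivity, since two equal generators could not be separated.\<close>

lemma irredundant_gens:
  assumes n: "n > 1"
  defines "S \<equiv> lower_gen n ` {..<n - 1} \<union> upper_gen n ` {..<n} :: 'a::field mat set"
  shows "irredundant_generating_set n S" "finite S" "card S = 2 * n - 1"
proof -
  let ?I = "{..<n - 1} <+> {..<n}"
  let ?x = "case_sum (lower_gen n) (upper_gen n) :: nat + nat \<Rightarrow> 'a mat"
  have S: "S = ?x ` ?I" unfolding S_def by (auto simp: Plus_def image_Un image_image)
  note sep = gens_separated[OF n, where ?'a = 'a]
  have "inj_on ?x ?I"
  proof (rule inj_onI, rule ccontr)
    fix k l assume "k \<in> ?I" "l \<in> ?I" "?x k = ?x l" "k \<noteq> l"
    then show False using sep[of k] by metis
  qed
  then have "card S = card ?I" unfolding S by (rule card_image)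
  then show "card S = 2 * n - 1" using n by (simp add: card_Plus)
  show "finite S" unfolding S_def by simp
  show "irredundant_generating_set n S"
    unfolding irredundant_generating_set_def
  proof (intro conjI allI impI)
    show "generates n S" unfolding S_def using n by (intro gens_generate) simp
    fix T assume "T \<subset> S"
    then obtain k where k: "k \<in> ?I" "?x k \<notin> T" "T \<subseteq> ?x ` ?I" unfolding S by blast
    obtain A where A: "unital_subalgebra n A" "?x k \<notin> A" "\<And>l. l \<in> ?I \<Longrightarrow> l \<noteq> k \<Longrightarrow> ?x l \<in> A"
      using sep[OF k(1)] by blast
    have "T \<subseteq> A" using A(3) k by blast
    moreover have "?x k \<in> carrier_mat n n" by (auto split: sum.split)
    ultimately show "\<not> generates n T" using A(1,2) unfolding generates_iff by blast
  qed
qed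

theorem theorem1p1:
  fixes n :: nat
  assumes "n > 1"
  shows "(\<exists>S :: 'a::field mat set. irredundant_generating_set n S \<and> finite S \<and> card S = 2 * n - 1) \<and>
         (\<forall>S :: 'a mat set. irredundant_generating_set n S \<longrightarrow> finite S \<and> card S \<le> 2 * n - 1)"
  using irredundant_gens[OF assms] irredundant_card_le[of n] assms by auto

end
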